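(* There exists a constant $\gamma>0$ such that the following holds. Let $G=(U,V,E)$ be a finite bipartite graph with a probability distribution $e$ on $E$ such that $(G,e)$ satisfies $\gamma$-weak independence for databases of size $n$ and the $(K,\frac1m,\frac{\gamma}{t})$-weak shattering property. Then for $t\le n^{1/4}$, any deterministic $t$-probe cell-probe data structure, with tables of $m$ cells of $w$ bits, for the distribution over GNS instances defined by $(G,e)$ that succeeds with probability $1-\gamma$ must use space $$m=\Omega\!\left(\frac{\gamma^3 n K^{\frac{1}{2t}}}{w t^3\log(t/\gamma)}\right).$$
   Context: For sets $B\subseteq U$, $A\subseteq V$ write $e(B,A)=\sum_{u\in B,v\in A}e(u,v)$. Let $\mu(u)=e(u,V)$, $\nu(v)=e(U,v)$, and for $x\in U$, $\nu_x(y)=e(x,y)/e(x,V)$. GNS on $G$: input database $(x_1,b_1),\dots,(x_n,b_n)$, $x_i\in U$, $b_i\in\{0,1\}$; on query $y\in V$, if $x_i$ is the unique neighbour of $y$ among $x_1,\dots,x_n$ the correct answer is $b_i$, otherwise any answer is correct. The distribution over GNS instances defined by $(G,e)$: $x_1,\dots,x_n$ i.i.d. from $\mu$, $b_1,\dots,b_n$ i.i.d. uniform bits, $i\in[n]$ uniform, query $y\sim\nu_{x_i}$. $\gamma$-weak independence: $\Pr_{x,z\sim\mu\text{ indep.},\,y\sim\nu_x}[(y,z)\in E]\le\gamma/n$. For $a\in\mathbb R$, $(a)^+=\max(a,0)$. A collection $A_1,\dots,A_k$ of disjoint subsets of $V$ is $\beta$-sparse if $\max_i\nu(A_i)\le\beta$;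 it $(K,\gamma')$-weakly shatters $x\in U$ if $\sum_i(\nu_x(A_i)-\frac1K)^+\le\gamma'\nu(\bigcup_iA_i)$. $(G,e)$ has the $(K,\beta,\gamma')$-weak shattering property if for every $\beta$-sparse collection of disjoint subsets $A_1,\dots,A_k$ of $V$, $\Pr_{x\sim\mu}[A_1,\dots,A_k\ (K,\gamma')\text{-weakly shatters }x]\ge1-\gamma'$. A deterministic $t$-probe cell-probe data structure: preprocessing produces tables $T_1,\dots,T_t$ of $m$ cells of $w$ bits; queries use fixed functions $F_1,\dots,F_t,F_*$, reading $c_k=T_k[F_k(y,c_1,\dots,c_{k-1})]$ and outputting $F_*(y,c_1,\dots,c_t)$.
   Formalization: The formal theorem also assumes that every single query y in V has ν(y) ≤ 1/m; without this the claim fails (uniform perfect matching on N < m points, where shattering is vacuous for every K). *)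

theory Defs
  imports "HOL-Probability.Probability"
begin

definition weighted_bipartite ::
  "'u set \<Rightarrow> 'v set \<Rightarrow> ('u \<times> 'v) set \<Rightarrow> ('u \<times> 'v) pmf \<Rightarrow> bool" where
  "weighted_bipartite U V E e \<longleftrightarrow>
     finite U \<and> finite V \<and> E \<subseteq> U \<times> V \<and> set_pmf e \<subseteq> E"

definition mu :: "('u \<times> 'v) pmf \<Rightarrow> 'u pmf" where
  "mu e = map_pmf fst e"

definition nu :: "('u \<times> 'v) pmf \<Rightarrow> 'v pmf" where
  "nu e = map_pmf snd e"

text \<open>The conditional distribution \<open>\<nu>\<^sub>x\<close>. It is meaningful only for \<open>x\<close> in the support of
  \<open>\<mu>\<close>; all uses below draw \<open>x\<close> from \<open>\<mu>\<close>.\<close>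

definition nu_at :: "('u \<times> 'v) pmf \<Rightarrow> 'u \<Rightarrow> 'v pmf" where
  "nu_at e x = map_pmf snd (cond_pmf e {p. fst p = x})"

lemma pmf_mu:
  assumes "weighted_bipartite U V E e"
  shows "pmf (mu e) u = (\<Sum>v\<in>V. pmf e (u, v))"
proof -
  have fin: "finite V" and sub: "set_pmf e \<subseteq> U \<times> V"
    using assms by (auto simp: weighted_bipartite_def)
  have "pmf (mu e) u = measure_pmf.prob e (fst -` {u})"
    by (simp add: mu_def pmf_map)
  also have "\<dots> = measure_pmf.prob e ({u} \<times> V)"
    using sub by (intro measure_pmf.finite_measure_eq_AE) (auto simp: AE_measure_pmf_iff)
  also have "\<dots> = sum (pmf e) ({u} \<times> V)"
    using fin by (intro measure_measure_pmf_finite) auto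
  also have "\<dots> = (\<Sum>v\<in>V. pmf e (u, v))"
    by (simp add: sum.cartesian_product')
  finally show ?thesis .
qed

lemma pmf_nu:
  assumes "weighted_bipartite U V E e"
  shows "pmf (nu e) v = (\<Sum>u\<in>U. pmf e (u, v))"
proof -
  have fin: "finite U" and sub: "set_pmf e \<subseteq> U \<times> V"
    using assms by (auto simp: weighted_bipartite_def)
  have "pmf (nu e) v = measure_pmf.prob e (snd -` {v})"
    by (simp add: nu_def pmf_map)
  also have "\<dots> = measure_pmf.prob e (U \<times> {v})"
    using sub by (intro measure_pmf.finite_measure_eq_AE) (auto simp: AE_measure_pmf_iff)
  also have "\<dots> = sum (pmf e) (U \<times> {v})"
    using fin by (intro measure_measure_pmf_finite) auto
  also have "\<dots> = (\<Sum>u\<in>U. pmf e (u, v))"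
    by (simp add: sum.cartesian_product')
  finally show ?thesis .
qed

lemma pmf_nu_at:
  assumes "x \<in> set_pmf (mu e)"
  shows "pmf (nu_at e x) y = pmf e (x, y) / pmf (mu e) x"
proof -
  have ne: "set_pmf e \<inter> {p. fst p = x} \<noteq> {}"
    using assms by (auto simp: mu_def)
  have "pmf (nu_at e x) y = measure_pmf.prob (cond_pmf e {p. fst p = x}) (snd -` {y})"
    by (simp add: nu_at_def pmf_map)
  also have "\<dots> = measure_pmf.prob (cond_pmf e {p. fst p = x}) {(x, y)}"
    using ne by (intro measure_pmf.finite_measure_eq_AE) (auto simp: AE_measure_pmf_iff)
  also have "\<dots> = pmf e (x, y) / measure_pmf.prob e {p. fst p = x}"
    using ne by (simp add: measure_pmf_single pmf_cond)
  also have "{p. fst p = x} = fst -` {x}" by auto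
  also have "measure_pmf.prob e (fst -` {x}) = pmf (mu e) x"
    by (simp add: mu_def pmf_map)
  finally show ?thesis .
qed

definition weak_independence ::
  "('u \<times> 'v) set \<Rightarrow> ('u \<times> 'v) pmf \<Rightarrow> real \<Rightarrow> nat \<Rightarrow> bool" where
  "weak_independence E e \<gamma> n \<longleftrightarrow>
     measure_pmf.prob
       (do { x \<leftarrow> mu e; z \<leftarrow> mu e; y \<leftarrow> nu_at e x; return_pmf (z, y) }) E \<le> \<gamma> / real n"

text \<open>A collection \<open>A\<^sub>1, \<dots>, A\<^sub>k\<close> is represented by \<open>A :: nat \<Rightarrow> 'v set\<close> restricted to
  the indices \<open>i < k\<close>. Empty members are allowed.\<close>

definition sparse_collection ::
  "('u \<times> 'v) pmf \<Rightarrow> real \<Rightarrow> nat \<Rightarrow> (nat \<Rightarrow> 'v set) \<Rightarrow> bool" where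
  "sparse_collection e \<beta> k A \<longleftrightarrow> (\<forall>i<k. measure_pmf.prob (nu e) (A i) \<le> \<beta>)"

definition weakly_shatters ::
  "('u \<times> 'v) pmf \<Rightarrow> real \<Rightarrow> real \<Rightarrow> nat \<Rightarrow> (nat \<Rightarrow> 'v set) \<Rightarrow> 'u \<Rightarrow> bool" where
  "weakly_shatters e K \<gamma>' k A x \<longleftrightarrow>
     (\<Sum>i<k. max (measure_pmf.prob (nu_at e x) (A i) - 1 / K) 0)
       \<le> \<gamma>' * measure_pmf.prob (nu e) (\<Union>i<k. A i)"

definition weak_shattering_property ::
  "'v set \<Rightarrow> ('u \<times> 'v) pmf \<Rightarrow> real \<Rightarrow> real \<Rightarrow> real \<Rightarrow> bool" where
  "weak_shattering_property V e K \<beta> \<gamma>' \<longleftrightarrow>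
     (\<forall>k A. (\<forall>i<k. A i \<subseteq> V) \<and> disjoint_family_on A {..<k} \<and> sparse_collection e \<beta> k A
        \<longrightarrow> measure_pmf.prob (mu e) {x. weakly_shatters e K \<gamma>' k A x} \<ge> 1 - \<gamma>')"

text \<open>Uniqueness of the neighbour is a statement about database positions: if the same
  point occurs at two positions, neither occurrence is a unique neighbour.\<close>

definition unique_neighbour ::
  "('u \<times> 'v) set \<Rightarrow> ('u \<times> bool) list \<Rightarrow> 'v \<Rightarrow> nat \<Rightarrow> bool" where
  "unique_neighbour E db y i \<longleftrightarrow>
     i < length db \<and> (fst (db ! i), y) \<in> E \<and>
     (\<forall>j<length db. (fst (db ! j), y) \<in> E \<longrightarrow> j = i)"

definition correct_answer ::
  "('u \<times> 'v) set \<Rightarrow> ('u \<times> bool) list \<Rightarrow> 'v \<Rightarrow> bool \<Rightarrow> bool" where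
  "correct_answer E db y a \<longleftrightarrow> (\<forall>i. unique_neighbour E db y i \<longrightarrow> a = snd (db ! i))"

text \<open>The distribution is meaningful for \<open>n > 0\<close>.\<close>

definition gns_distribution ::
  "('u \<times> 'v) pmf \<Rightarrow> nat \<Rightarrow> (('u \<times> bool) list \<times> 'v) pmf" where
  "gns_distribution e n =
     do { xs \<leftarrow> replicate_pmf n (mu e);
          bs \<leftarrow> replicate_pmf n (pmf_of_set (UNIV :: bool set));
          i \<leftarrow> pmf_of_set {..<n};
          y \<leftarrow> nu_at e (xs ! i);
          return_pmf (zip xs bs, y) }"

text \<open>Probes are numbered from \<open>0\<close>, cells from \<open>0\<close> to \<open>m - 1\<close>. \<open>table D db k j\<close> is the content
  of cell \<open>j\<close> of the table read by probe \<open>k\<close> when the database is \<open>db\<close>. The functions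
  \<open>probe\<close> and \<open>answer_fun\<close> do not depend on the database; their list argument holds
  the contents of the cells already read, oldest first.\<close>

record ('u, 'v) cell_probe =
  table :: "('u \<times> bool) list \<Rightarrow> nat \<Rightarrow> nat \<Rightarrow> bool list"
  probe :: "nat \<Rightarrow> 'v \<Rightarrow> bool list list \<Rightarrow> nat"
  answer_fun :: "'v \<Rightarrow> bool list list \<Rightarrow> bool"

definition cell_probe_structure ::
  "'u set \<Rightarrow> 'v set \<Rightarrow> nat \<Rightarrow> nat \<Rightarrow> nat \<Rightarrow> nat \<Rightarrow> ('u, 'v) cell_probe \<Rightarrow> bool" where
  "cell_probe_structure U V n t m w D \<longleftrightarrow>
     (\<forall>db k j. length db = n \<and> fst ` set db \<subseteq> U \<and> k < t \<and> j < m \<longrightarrow>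
        length (table D db k j) = w) \<and>
     (\<forall>k y cs. k < t \<and> y \<in> V \<and> length cs = k \<and> (\<forall>c\<in>set cs. length c = w) \<longrightarrow>
        probe D k y cs < m)"

fun cells_read ::
  "('u, 'v) cell_probe \<Rightarrow> ('u \<times> bool) list \<Rightarrow> 'v \<Rightarrow> nat \<Rightarrow> bool list list" where
  "cells_read D db y 0 = []"
| "cells_read D db y (Suc k) =
     (let cs = cells_read D db y k in cs @ [table D db k (probe D k y cs)])"

definition run_query ::
  "('u, 'v) cell_probe \<Rightarrow> nat \<Rightarrow> ('u \<times> bool) list \<Rightarrow> 'v \<Rightarrow> bool" where
  "run_query D t db y = answer_fun D y (cells_read D db y t)"

definition success_probability ::
  "('u \<times> 'v) set \<Rightarrow> ('u \<times> 'v) pmf \<Rightarrow> nat \<Rightarrow> nat \<Rightarrow> ('u, 'v) cell_probe \<Rightarrow> real" where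
  "success_probability E e n t D =
     measure_pmf.prob (gns_distribution e n)
       {(db, y). correct_answer E db y (run_query D t db y)}"

text \<open>In the theorem, vertices are natural numbers. Every finite bipartite graph has an
  isomorphic copy of this form, and the constants then cannot depend on a vertex type.
  The two sides play separate roles (edges are ordered pairs), so \<open>U\<close> and \<open>V\<close> need not be
  disjoint as sets of numbers.

  The theorem assumes that no single query has \<open>\<nu>\<close>-mass above \<open>1/m\<close>. Without it, a query set
  all of whose points are heavier than \<open>1/m\<close> has no \<open>1/m\<close>-sparse collection except null sets,
  the shattering property is vacuous for every \<open>K\<close>, and the bound fails.\<close>

end

theory Submission
  imports Defs
begin

text \<open>Keep each cell of each table independently with probability \<open>p\<close>, so that a query survives
  all \<open>t\<close> probes with probability \<open>p ^ t\<close>, whatever it is. Wrong answers survive at exactly this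
  rate, and for a shattered \<open>x\<close> a second moment bound shows that the \<open>\<nu>\<^sub>x\<close>-mass of the surviving
  queries is at least \<open>(3 / 4) p ^ t\<close> with probability close to one. Hence for most \<open>i\<close> the bit \<open>b\<^sub>i\<close> is
  the majority answer, under \<open>\<nu>\<^sub>x\<close> with \<open>x = x\<^sub>i\<close>, of the surviving queries, and these answers depend only
  on the contents of the kept cells. For fixed contents the points \<open>x\<^sub>i\<close> are independent of everything
  that determines the surviving queries, so Chernoff bounds and a union bound over all contents
  show that few contents cannot describe most of the bits: the kept cells must hold \<open>\<Omega>(n)\<close> bits,
  that is, \<open>t p m w = \<Omega>(n)\<close>. The second moment bound needs \<open>K p ^ t \<ge> const * t\<^sup>2\<close> or \<open>p = 1\<close>,
  and \<open>p = min 1 (const / K powr (1 / (2 * t)))\<close> satisfies this.\<close>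

section \<open>Averages over finitely supported distributions\<close>

text \<open>If the support is infinite, \<open>avg\<close> is \<open>0\<close>.\<close>

definition avg :: "'a pmf \<Rightarrow> ('a \<Rightarrow> real) \<Rightarrow> real" where
  "avg p f = (\<Sum>x\<in>set_pmf p. pmf p x * f x)"

lemma avg_cong: "(\<And>x. x \<in> set_pmf p \<Longrightarrow> f x = g x) \<Longrightarrow> avg p f = avg p g"
  by (simp add: avg_def)

lemma avg_mono: "(\<And>x. x \<in> set_pmf p \<Longrightarrow> f x \<le> g x) \<Longrightarrow> avg p f \<le> avg p g"
  by (auto simp: avg_def intro!: sum_mono mult_left_mono)

lemma avg_nonneg: "(\<And>x. x \<in> set_pmf p \<Longrightarrow> 0 \<le> f x) \<Longrightarrow> 0 \<le> avg p f"
  by (auto simp: avg_def intro!: sum_nonneg)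

lemma avg_add: "avg p (\<lambda>x. f x + g x) = avg p f + avg p g"
  by (simp add: avg_def sum.distrib distrib_left)

lemma avg_sum: "avg p (\<lambda>x. \<Sum>i\<in>A. f i x) = (\<Sum>i\<in>A. avg p (f i))"
  unfolding avg_def by (subst sum.swap) (simp add: sum_distrib_left)

lemma avg_cmult: "avg p (\<lambda>x. c * f x) = c * avg p f"
  by (simp add: avg_def sum_distrib_left mult.left_commute)

lemma avg_multc: "avg p (\<lambda>x. f x * c) = avg p f * c"
  by (simp add: avg_def sum_distrib_right mult.assoc)

lemma avg_divide: "avg p (\<lambda>x. f x / c) = avg p f / c"
  by (simp add: avg_def sum_divide_distrib)

lemma avg_const: "finite (set_pmf p) \<Longrightarrow> avg p (\<lambda>x. c) = c"
  by (simp add: avg_def sum_distrib_right[symmetric] sum_pmf_eq_1)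

lemma avg_swap: "avg p (\<lambda>x. avg q (\<lambda>y. f x y)) = avg q (\<lambda>y. avg p (\<lambda>x. f x y))"
  unfolding avg_def by (simp add: sum_distrib_left, subst sum.swap) (simp add: mult_ac)

lemma avg_eq_expectation: "finite (set_pmf p) \<Longrightarrow> avg p f = measure_pmf.expectation p f"
  by (subst integral_measure_pmf_real[of "set_pmf p"]) (auto simp: avg_def mult.commute)

lemma avg_return [simp]: "avg (return_pmf x) f = f x"
  by (simp add: avg_def)

lemma avg_bind:
  assumes "finite (set_pmf p)" "\<And>x. x \<in> set_pmf p \<Longrightarrow> finite (set_pmf (f x))"
  shows "avg (bind_pmf p f) h = avg p (\<lambda>x. avg (f x) h)"
proof -
  have "avg (bind_pmf p f) h = measure_pmf.expectation (bind_pmf p f) h"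
    using assms by (intro avg_eq_expectation) auto
  also have "\<dots> = (\<Sum>x\<in>set_pmf p. pmf p x *\<^sub>R measure_pmf.expectation (f x) h)"
    using assms by (intro pmf_expectation_bind) auto
  also have "\<dots> = avg p (\<lambda>x. avg (f x) h)"
    unfolding avg_def[of p] using assms by (intro sum.cong) (auto simp: avg_eq_expectation)
  finally show ?thesis .
qed

lemma prob_eq_avg: "finite (set_pmf p) \<Longrightarrow> measure_pmf.prob p A = avg p (indicator A)"
  by (simp add: avg_eq_expectation)

lemma avg_pmf_of_set:
  "finite A \<Longrightarrow> A \<noteq> {} \<Longrightarrow> avg (pmf_of_set A) f = (\<Sum>x\<in>A. f x) / card A"
  by (simp add: avg_def sum_divide_distrib)

lemma avg_pair:
  assumes "finite (set_pmf p)" "finite (set_pmf q)"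
  shows "avg (pair_pmf p q) f = avg p (\<lambda>x. avg q (\<lambda>y. f (x, y)))"
  unfolding pair_pmf_def using assms by (simp add: avg_bind)

lemma avg_bernoulli:
  assumes "0 < p" "p \<le> 1"
  shows "avg (bernoulli_pmf p) f = p * f True + (1 - p) * f False"
  using assms by (subst avg_eq_expectation) auto

lemma markov_avg:
  assumes "finite (set_pmf p)" "\<And>x. x \<in> set_pmf p \<Longrightarrow> 0 \<le> f x"
    "\<And>x. x \<in> set_pmf p \<Longrightarrow> x \<in> A \<Longrightarrow> 1 \<le> f x"
  shows "measure_pmf.prob p A \<le> avg p f"
  unfolding prob_eq_avg[OF assms(1)] using assms by (intro avg_mono) (auto simp: indicator_def)

section \<open>Product distributions: resampling and tail bounds\<close>

lemma finite_replicate_pmf: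
  assumes "finite (set_pmf p)" shows "finite (set_pmf (replicate_pmf n p))"
  using finite_lists_length_eq[OF assms, of n]
  by (rule finite_subset[rotated]) (auto simp: set_replicate_pmf)

lemma avg_replicate_Suc:
  assumes "finite (set_pmf p)"
  shows "avg (replicate_pmf (Suc n) p) f = avg p (\<lambda>x. avg (replicate_pmf n p) (\<lambda>xs. f (x # xs)))"
  using assms by (simp add: avg_bind finite_replicate_pmf)

text \<open>Coordinates of a product distribution are independent, so redrawing one leaves the law
  unchanged. This allows averaging over coordinate \<open>k\<close> alone while everything
  determined by the others stays fixed.\<close>

lemma avg_resample:
  assumes "finite (set_pmf p)" "k < n"
  shows "avg (replicate_pmf n p) f = avg (replicate_pmf n p) (\<lambda>xs. avg p (\<lambda>s. f (xs[k := s])))"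
  using assms(2)
proof (induction n arbitrary: f k)
  case (Suc n)
  show ?case
  proof (cases k)
    case 0
    show ?thesis
      unfolding avg_replicate_Suc[OF assms(1)] 0
      by (simp add: avg_const[OF assms(1)]) (rule avg_swap)
  next
    case (Suc j)
    then have "avg (replicate_pmf n p) g = avg (replicate_pmf n p) (\<lambda>xs. avg p (\<lambda>s. g (xs[j := s])))" for g
      using Suc.IH[of j] Suc.prems by simp
    from this[of "\<lambda>xs. f (x # xs)" for x] show ?thesis
      unfolding avg_replicate_Suc[OF assms(1)] \<open>k = Suc j\<close> list_update.simps nat.case by simp
  qed
qed simp

text \<open>Redrawing both coordinates turns them into independent draws, and nothing of the
  original list remains.\<close>

lemma avg_two_coordinates:
  assumes "finite (set_pmf p)" "i < n" "j < n" "i \<noteq> j"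
  shows "avg (replicate_pmf n p) (\<lambda>xs. f (xs ! i) (xs ! j)) = avg p (\<lambda>a. avg p (\<lambda>b. f a b))"
proof -
  have "avg (replicate_pmf n p) (\<lambda>xs. f (xs ! i) (xs ! j)) =
    avg (replicate_pmf n p) (\<lambda>xs. avg p (\<lambda>a. avg p (\<lambda>b. f (xs[i := a, j := b] ! i) (xs[i := a, j := b] ! j))))"
    by (subst avg_resample[OF assms(1,3)], subst avg_resample[OF assms(1,2)]) simp
  also have "\<dots> = avg (replicate_pmf n p) (\<lambda>xs. avg p (\<lambda>a. avg p (\<lambda>b. f a b)))"
    using assms by (intro avg_cong) (auto simp: set_replicate_pmf)
  finally show ?thesis
    by (simp add: avg_const finite_replicate_pmf assms)
qed

text \<open>Chernoff bound: Markov's inequality for \<open>s\<close> to the number of hits, whose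
  mean factors over the coordinates. The base \<open>s\<close> stays free because the applications
  need very different values.\<close>

lemma prob_count_ge:
  fixes s q a :: real
  assumes fin: "finite (set_pmf p)" and s: "1 \<le> s" and q: "measure_pmf.prob p {x. Q x} \<le> q"
  shows "measure_pmf.prob (replicate_pmf n p) {xs. a * n \<le> card {i. i < n \<and> Q (xs ! i)}}
    \<le> ((1 + q * (s - 1)) / s powr a) ^ n"
proof -
  define F where "F = (\<lambda>(n::nat) xs. \<Prod>i<n. if Q (xs ! i) then s else 1)"
  have step: "avg p (\<lambda>x. if Q x then s else 1) \<le> 1 + q * (s - 1)"
  proof -
    have "avg p (\<lambda>x. if Q x then s else 1) = avg p (\<lambda>x. 1 + indicator {x. Q x} x * (s - 1))"
      by (intro avg_cong) (auto simp: indicator_def)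
    also have "\<dots> = 1 + measure_pmf.prob p {x. Q x} * (s - 1)"
      by (simp add: avg_add avg_multc avg_const fin prob_eq_avg)
    also have "\<dots> \<le> 1 + q * (s - 1)"
      using q s by (intro add_left_mono mult_right_mono) auto
    finally show ?thesis .
  qed
  have mgf: "avg (replicate_pmf n p) (F n) \<le> (1 + q * (s - 1)) ^ n" for n
  proof (induction n)
    case (Suc n)
    have "avg (replicate_pmf (Suc n) p) (F (Suc n)) =
      avg p (\<lambda>x. (if Q x then s else 1) * avg (replicate_pmf n p) (F n))"
      unfolding avg_replicate_Suc[OF fin] F_def
      by (simp only: prod.lessThan_Suc_shift nth_Cons_0 nth_Cons_Suc avg_cmult)
    also have "\<dots> = avg p (\<lambda>x. (if Q x then s else 1)) * avg (replicate_pmf n p) (F n)"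
      by (rule avg_multc)
    also have "\<dots> \<le> (1 + q * (s - 1)) * (1 + q * (s - 1)) ^ n"
      using Suc.IH step s
      by (intro mult_mono avg_nonneg)
         (auto simp: F_def intro!: prod_nonneg order_trans[OF _ step] avg_nonneg)
    finally show ?case by simp
  qed (simp add: F_def)
  have "measure_pmf.prob (replicate_pmf n p) {xs. a * n \<le> card {i. i < n \<and> Q (xs ! i)}}
    \<le> avg (replicate_pmf n p) (\<lambda>xs. F n xs / s powr (a * n))"
  proof (rule markov_avg[OF finite_replicate_pmf[OF fin]])
    fix xs
    show "0 \<le> F n xs / s powr (a * n)"
      using s by (auto simp: F_def intro!: divide_nonneg_nonneg prod_nonneg)
    assume "xs \<in> {xs. a * n \<le> card {i. i < n \<and> Q (xs ! i)}}"
    then have c: "a * n \<le> card {i. i < n \<and> Q (xs ! i)}" by simp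
    have "F n xs = (\<Prod>i\<in>{i. i < n \<and> Q (xs ! i)}. s)"
      unfolding F_def by (rule prod.mono_neutral_cong_right) auto
    also have "\<dots> = s powr card {i. i < n \<and> Q (xs ! i)}"
      using s by (simp add: powr_realpow)
    also have "\<dots> \<ge> s powr (a * n)"
      using c s by (rule powr_mono)
    finally show "1 \<le> F n xs / s powr (a * n)"
      using s by simp
  qed
  also have "\<dots> \<le> (1 + q * (s - 1)) ^ n / s powr (a * n)"
    unfolding avg_divide using mgf[of n] by (intro divide_right_mono) auto
  also have "s powr (a * n) = (s powr a) ^ n"
    using s by (simp add: powr_powr[symmetric] powr_realpow)
  finally show ?thesis
    by (simp add: power_divide)
qed

text \<open>The first bit may be drawn before the remaining points, so separate lists of points and
  bits amount to independent entries.\<close>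

lemma replicate_pmf_pair:
  "replicate_pmf n (pair_pmf p q) =
    do {xs \<leftarrow> replicate_pmf n p; bs \<leftarrow> replicate_pmf n q; return_pmf (zip xs bs)}"
proof (induction n)
  case (Suc n)
  show ?case
    unfolding replicate_pmf.simps Suc.IH unfolding pair_pmf_def
    by (simp add: bind_assoc_pmf bind_return_pmf)
       (subst bind_commute_pmf[of q], rule refl)
qed (simp add: bind_return_pmf)

section \<open>Random subsets with independent membership\<close>

fun random_subset :: "real \<Rightarrow> nat \<Rightarrow> nat set pmf" where
  "random_subset p 0 = return_pmf {}"
| "random_subset p (Suc n) =
     do {S \<leftarrow> random_subset p n; b \<leftarrow> bernoulli_pmf p; return_pmf (if b then insert n S else S)}"

lemma set_random_subset: "set_pmf (random_subset p n) \<subseteq> Pow {..<n}"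
proof (induction n)
  case (Suc n)
  then show ?case by (auto simp: less_Suc_eq subset_iff split: if_splits)
qed simp

lemma finite_random_subset [simp]: "finite (set_pmf (random_subset p n))"
  using set_random_subset[of p n] by (rule finite_subset) auto

context
  fixes p :: real
  assumes p: "0 < p" "p \<le> 1"
begin

lemma avg_random_subset_Suc:
  "avg (random_subset p (Suc n)) f =
    avg (random_subset p n) (\<lambda>S. p * f (insert n S) + (1 - p) * f S)"
  using p by (simp add: avg_bind avg_bernoulli)

lemma sum_insert_random_subset:
  assumes "S \<in> set_pmf (random_subset p n)"
  shows "(\<Sum>q\<in>insert n S. a q) = (\<Sum>q\<in>S. a q) + (a n :: real)"
proof -
  have "S \<subseteq> {..<n}" using subsetD[OF set_random_subset assms] by simp
  then show ?thesis
    using finite_subset by (subst sum.insert) auto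
qed

lemma avg_sum_random_subset:
  "avg (random_subset p n) (\<lambda>S. \<Sum>q\<in>S. a q) = p * (\<Sum>q<n. a q)"
proof (induction n)
  case (Suc n)
  have "avg (random_subset p (Suc n)) (\<lambda>S. \<Sum>q\<in>S. a q) =
      avg (random_subset p n) (\<lambda>S. (\<Sum>q\<in>S. a q) + p * a n)"
    unfolding avg_random_subset_Suc
    by (intro avg_cong) (simp add: sum_insert_random_subset algebra_simps)
  then show ?case
    by (simp add: avg_add avg_const Suc.IH algebra_simps)
qed simp

text \<open>Element \<open>n\<close> adds a centred term independent of the rest, so the cross term
  vanishes and the variances add.\<close>

lemma variance_random_subset:
  "avg (random_subset p n) (\<lambda>S. ((\<Sum>q\<in>S. a q) - p * (\<Sum>q<n. a q))\<^sup>2) =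
    p * (1 - p) * (\<Sum>q<n. (a q)\<^sup>2)"
proof (induction n)
  case (Suc n)
  have "avg (random_subset p (Suc n)) (\<lambda>S. ((\<Sum>q\<in>S. a q) - p * (\<Sum>q<Suc n. a q))\<^sup>2) =
      avg (random_subset p n)
        (\<lambda>S. ((\<Sum>q\<in>S. a q) - p * (\<Sum>q<n. a q))\<^sup>2 + p * (1 - p) * (a n)\<^sup>2)"
    unfolding avg_random_subset_Suc
    by (intro avg_cong)
       (simp only: sum_insert_random_subset sum.lessThan_Suc, simp add: power2_eq_square algebra_simps)
  also have "\<dots> = p * (1 - p) * (\<Sum>q<n. (a q)\<^sup>2) + p * (1 - p) * (a n)\<^sup>2"
    by (simp only: avg_add avg_const finite_random_subset Suc.IH)
  finally show ?case
    by (simp only: sum.lessThan_Suc distrib_left)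
qed simp

lemma prob_mem_random_subset:
  assumes "j < n"
  shows "avg (random_subset p n) (\<lambda>S. (if j \<in> S then 1 else 0)) = p"
proof -
  have "avg (random_subset p n) (\<lambda>S. (if j \<in> S then 1 else 0)) =
      avg (random_subset p n) (\<lambda>S. \<Sum>q\<in>S. (if q = j then 1 else 0))"
  proof (rule avg_cong)
    fix S assume "S \<in> set_pmf (random_subset p n)"
    then have "finite S" by (meson PowD finite_lessThan finite_subset set_random_subset subsetD)
    then show "(if j \<in> S then 1 else 0 :: real) = (\<Sum>q\<in>S. (if q = j then 1 else 0) :: real)"
      using sum.delta[of S j "\<lambda>_. 1::real"] by simp
  qed
  also have "\<dots> = p"
    using assms by (simp add: avg_sum_random_subset)
  finally show ?thesis .
qed

end

section \<open>Sampling cells\<close>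

text \<open>In a refinement with the fewest classes, any two classes inside one class of \<open>f\<close> weigh more
  than \<open>1 / m\<close> together; so each class of \<open>f\<close> contains at most one of weight \<open>\<le> 1 / (2m)\<close>.\<close>

lemma exists_light_refinement:
  fixes q :: "'v pmf" and f :: "'v \<Rightarrow> nat"
  assumes fin: "finite V" and m: "0 < m" and light: "\<And>y. y \<in> V \<Longrightarrow> pmf q y \<le> 1 / real m"
    and f: "\<And>y. y \<in> V \<Longrightarrow> f y < m"
  shows "\<exists>g. (\<forall>y\<in>V. g y < 3 * m) \<and> (\<forall>y\<in>V. \<forall>y'\<in>V. g y = g y' \<longrightarrow> f y = f y') \<and>
    (\<forall>i::nat. measure_pmf.prob q {y\<in>V. g y = i} \<le> 1 / real m)"
proof -
  define good where "good g \<longleftrightarrow> (\<forall>y\<in>V. \<forall>y'\<in>V. g y = g y' \<longrightarrow> f y = f y') \<and>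
    (\<forall>i::nat. measure_pmf.prob q {y\<in>V. g y = i} \<le> 1 / real m)" for g
  \<comment> \<open>An injective map shows that good refinements exist: its classes are single
    points, bounded by \<open>light\<close>.\<close>
  obtain g0 :: "'v \<Rightarrow> nat" where inj: "inj_on g0 V"
    using finite_imp_inj_to_nat_seg[OF fin] by blast
  have "measure_pmf.prob q {y\<in>V. g0 y = i} \<le> 1 / real m" for i
  proof (cases "\<exists>y\<in>V. g0 y = i")
    case True
    then obtain y where "y \<in> V" "g0 y = i" by blast
    then have "{y\<in>V. g0 y = i} = {y}" using inj by (auto dest: inj_onD)
    then show ?thesis using light[OF \<open>y \<in> V\<close>] by (simp add: measure_pmf_single)
  next
    case False
    then have "{y\<in>V. g0 y = i} = {}" by blast
    then show ?thesis by (simp only: measure_empty) simp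
  qed
  then have "good g0" using inj unfolding good_def by (auto dest: inj_onD)
  then obtain g where g: "good g" and least: "\<And>g'. good g' \<Longrightarrow> card (g ` V) \<le> card (g' ` V)"
    using ex_has_least_nat[of good g0 "\<lambda>g. card (g ` V)"] by blast
  define I where "I = g ` V"
  define C where "C i = {y\<in>V. g y = i}" for i
  define wt where "wt i = measure_pmf.prob q (C i)" for i
  \<comment> \<open>The value of \<open>f\<close> on class \<open>i\<close>, well defined because
    \<open>g\<close> refines \<open>f\<close>.\<close>
  define \<phi> where "\<phi> i = f (SOME y. y \<in> C i)" for i
  have finI: "finite I" using fin by (simp add: I_def)
  have \<phi>: "\<phi> (g y) = f y" if "y \<in> V" for y
  proof -
    define z where "z = (SOME y'. y' \<in> C (g y))"
    have "z \<in> C (g y)"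
      unfolding z_def by (rule someI[of _ y]) (simp add: C_def that)
    then have "f z = f y" using g that unfolding C_def good_def by blast
    then show ?thesis by (simp add: \<phi>_def z_def)
  qed
  \<comment> \<open>Otherwise moving class \<open>j\<close> into class \<open>i\<close> would give a
    good map with fewer classes.\<close>
  have merge: "1 / real m < wt i + wt j" if ij: "i \<in> I" "j \<in> I" "i \<noteq> j" "\<phi> i = \<phi> j" for i j
  proof (rule ccontr)
    assume *: "\<not> 1 / real m < wt i + wt j"
    define g' where "g' y = (if g y = j then i else g y)" for y
    have "measure_pmf.prob q {y\<in>V. g' y = l} \<le> 1 / real m" for l
    proof (cases "l = i")
      case True
      have "measure_pmf.prob q {y\<in>V. g' y = l} \<le> measure_pmf.prob q (C i \<union> C j)"
        using True by (intro measure_pmf.finite_measure_mono) (auto simp: C_def g'_def)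
      also have "\<dots> \<le> wt i + wt j"
        unfolding wt_def by (intro measure_Un_le) auto
      finally show ?thesis using * by simp
    next
      case False
      then have "measure_pmf.prob q {y\<in>V. g' y = l} \<le> wt l"
        unfolding wt_def by (intro measure_pmf.finite_measure_mono) (auto simp: C_def g'_def split: if_splits)
      also have "\<dots> \<le> 1 / real m" using g unfolding good_def wt_def C_def by blast
      finally show ?thesis .
    qed
    moreover have "f y = f y'" if "y \<in> V" "y' \<in> V" "g' y = g' y'" for y y'
    proof -
      have "\<phi> (g y) = \<phi> (g' y)" "\<phi> (g y') = \<phi> (g' y')"
        using ij by (auto simp: g'_def)
      then show ?thesis using that \<phi> by simp
    qed
    ultimately have "good g'" unfolding good_def by blast
    then have "card I \<le> card (g' ` V)" using least I_def by simp
    also have "\<dots> \<le> card (I - {j})"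
      using finI ij by (intro card_mono) (auto simp: g'_def I_def)
    also have "\<dots> < card I"
      using finI ij by (intro card_Diff1_less) auto
    finally show False by simp
  qed
  define Light where "Light = {i\<in>I. wt i \<le> 1 / (2 * real m)}"
  define Heavy where "Heavy = {i\<in>I. \<not> wt i \<le> 1 / (2 * real m)}"
  have "inj_on \<phi> Light"
  proof (rule inj_onI, rule ccontr)
    fix i j assume *: "i \<in> Light" "j \<in> Light" "\<phi> i = \<phi> j" "i \<noteq> j"
    then have "1 / real m < wt i + wt j" by (intro merge) (auto simp: Light_def)
    also have "\<dots> \<le> 1 / (2 * real m) + 1 / (2 * real m)"
      using * by (intro add_mono) (auto simp: Light_def)
    finally show False by simp
  qed
  moreover have "\<phi> ` Light \<subseteq> {..<m}"
    using \<phi> f by (auto simp: Light_def I_def)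
  ultimately have "card Light \<le> card {..<m}"
    by (intro card_inj_on_le) auto
  \<comment> \<open>Heavy classes are disjoint and weigh more than \<open>1 / (2 * m)\<close>, so
    there are at most \<open>2 * m\<close>; with at most \<open>m\<close> light ones this gives
    \<open>3 * m\<close>.\<close>
  moreover have "card Heavy \<le> 2 * m"
  proof -
    have "real (card Heavy) * (1 / (2 * real m)) \<le> (\<Sum>i\<in>Heavy. wt i)"
      by (intro sum_bounded_below) (auto simp: Heavy_def)
    also have "\<dots> = measure_pmf.prob q (\<Union>i\<in>Heavy. C i)"
      unfolding wt_def using finI
      by (intro measure_pmf.finite_measure_finite_Union[symmetric])
         (auto simp: Heavy_def disjoint_family_on_def C_def)
    also have "\<dots> \<le> 1" by simp
    finally have "real (card Heavy) \<le> real (2 * m)" using m by (simp add: field_simps)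
    then show ?thesis by linarith
  qed
  moreover have "card I \<le> card Light + card Heavy"
  proof -
    have "I = Light \<union> Heavy" by (auto simp: Light_def Heavy_def)
    then show ?thesis by (metis card_Un_le)
  qed
  ultimately have cardI: "card I \<le> 3 * m" by simp
  obtain h where h: "bij_betw h I {0..<card I}"
    using ex_bij_betw_finite_nat[OF finI] by blast
  have hI: "h (g y) = h (g y') \<longleftrightarrow> g y = g y'" if "y \<in> V" "y' \<in> V" for y y'
    using h that by (auto simp: bij_betw_def I_def dest: inj_onD)
  show ?thesis
  proof (intro exI[of _ "h \<circ> g"] conjI ballI allI impI)
    fix y assume "y \<in> V"
    then have "h (g y) \<in> {0..<card I}" using h by (auto simp: bij_betw_def I_def)
    then show "(h \<circ> g) y < 3 * m" using cardI by simp
  next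
    fix y y' assume "y \<in> V" "y' \<in> V" "(h \<circ> g) y = (h \<circ> g) y'"
    then have "g y = g y'" by (simp add: hI)
    then show "f y = f y'" using g \<open>y \<in> V\<close> \<open>y' \<in> V\<close> unfolding good_def by blast
  next
    fix i
    show "measure_pmf.prob q {y\<in>V. (h \<circ> g) y = i} \<le> 1 / real m"
    proof (cases "\<exists>y\<in>V. h (g y) = i")
      case True
      then obtain y where y: "y \<in> V" "h (g y) = i" by blast
      then have "{y\<in>V. (h \<circ> g) y = i} = {y'\<in>V. g y' = g y}"
        using hI[OF _ y(1)] by auto
      then show ?thesis using g unfolding good_def by metis
    next
      case False
      then have "{y\<in>V. (h \<circ> g) y = i} = {}" by auto
      then show ?thesis by (simp only: measure_empty) simp
    qed
  qed
qed

lemma prob_finite_UN_sum: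
  assumes "finite I" "disjoint_family_on A I"
  shows "measure_pmf.prob q (\<Union>i\<in>I. A i) = (\<Sum>i\<in>I. measure_pmf.prob q (A i))"
  using assms by (intro measure_pmf.finite_measure_finite_Union) auto

locale cell_sampling =
  fixes U :: "'u set" and V :: "'v set" and E :: "('u \<times> 'v) set" and e :: "('u \<times> 'v) pmf"
    and n t m w :: nat and K \<gamma> p :: real and D :: "('u, 'v) cell_probe"
  assumes graph: "weighted_bipartite U V E e"
    and t: "0 < t" and m: "0 < m" and K: "0 < K"
    and light: "\<forall>y\<in>V. pmf (nu e) y \<le> 1 / real m"
    and shattering: "weak_shattering_property V e K (1 / real m) (\<gamma> / real t)"
    and tables: "cell_probe_structure U V n t m w D"
    and p: "0 < p" "p \<le> 1"
begin

section \<open>Supports of the vertex distributions\<close>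

lemma finite_V: "finite V" and set_e: "set_pmf e \<subseteq> U \<times> V" and set_e_E: "set_pmf e \<subseteq> E"
  using graph by (auto simp: weighted_bipartite_def)

lemma finite_e [simp]: "finite (set_pmf e)"
  using set_e graph by (auto simp: weighted_bipartite_def intro: finite_subset)

lemma finite_mu [simp]: "finite (set_pmf (mu e))"
  by (simp add: mu_def)

lemma set_mu: "set_pmf (mu e) \<subseteq> U"
  using set_e by (auto simp: mu_def)

lemma set_nu: "set_pmf (nu e) \<subseteq> V"
  using set_e by (auto simp: nu_def)

lemma set_nu_at:
  assumes "x \<in> set_pmf (mu e)"
  shows "set_pmf (nu_at e x) = {y. (x, y) \<in> set_pmf e}"
proof -
  have "set_pmf e \<inter> {p. fst p = x} \<noteq> {}" using assms by (auto simp: mu_def)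
  then show ?thesis unfolding nu_at_def by (force simp: set_cond_pmf)
qed

lemma set_nu_at_V: "x \<in> set_pmf (mu e) \<Longrightarrow> set_pmf (nu_at e x) \<subseteq> V"
  using set_nu_at set_e by auto

lemma finite_nu_at: "x \<in> set_pmf (mu e) \<Longrightarrow> finite (set_pmf (nu_at e x))"
  using set_nu_at_V finite_V finite_subset by metis

text \<open>A cell may be probed by a set of queries of mass above \<open>1 / m\<close>, to which the shattering
  property does not apply. Therefore every table is replaced by \<open>3 * m\<close> virtual cells, each a copy of
  one cell that serves queries of mass at most \<open>1 / m\<close>.\<close>

definition refining :: "('v \<Rightarrow> nat) \<Rightarrow> 'v \<Rightarrow> nat" where
  "refining f = (SOME g. (\<forall>y\<in>V. g y < 3 * m) \<and> (\<forall>y\<in>V. \<forall>y'\<in>V. g y = g y' \<longrightarrow> f y = f y') \<and>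
    (\<forall>i. measure_pmf.prob (nu e) {y\<in>V. g y = i} \<le> 1 / real m))"

lemma refining:
  assumes "\<And>y. y \<in> V \<Longrightarrow> f y < m"
  shows "y \<in> V \<Longrightarrow> refining f y < 3 * m"
    and "y \<in> V \<Longrightarrow> y' \<in> V \<Longrightarrow> refining f y = refining f y' \<Longrightarrow> f y = f y'"
    and "measure_pmf.prob (nu e) {y\<in>V. refining f y = i} \<le> 1 / real m"
  using someI_ex[OF exists_light_refinement[of V m "nu e" f, OF finite_V m _ assms]] light
  unfolding refining_def[symmetric] by blast+

text \<open>The default \<open>0\<close> and the reduction modulo \<open>m\<close> yield a valid
  cell for every query and arbitrary guessed contents, so \<open>refining\<close> always applies.
  The whole map \<open>h\<close> is an argument because the refinement depends on the locations of
  all queries.\<close>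

definition location :: "nat \<Rightarrow> ('v \<Rightarrow> bool list list option) \<Rightarrow> 'v \<Rightarrow> nat" where
  "location k h y = (case h y of None \<Rightarrow> 0 | Some cs \<Rightarrow> probe D k y cs mod m)"

text \<open>\<open>run C s k y\<close> lists the first \<open>k\<close> cells read on query \<open>y\<close>, and is \<open>None\<close> once a probe hits a
  virtual cell outside the sample \<open>s\<close>. The virtual cell \<open>q\<close> of table \<open>k\<close>, a copy of cell \<open>l\<close>, holds
  \<open>C k q l\<close>: the true contents depend only on \<open>l\<close>, guessed contents only on \<open>q\<close>.\<close>

primrec run :: "(nat \<Rightarrow> nat \<Rightarrow> nat \<Rightarrow> bool list) \<Rightarrow> (nat \<Rightarrow> nat set) \<Rightarrow> nat \<Rightarrow>
    'v \<Rightarrow> bool list list option" where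
  "run C s 0 = (\<lambda>y. if y \<in> V then Some [] else None)"
| "run C s (Suc k) = (\<lambda>y. case run C s k y of None \<Rightarrow> None | Some cs \<Rightarrow>
     let l = location k (run C s k) in
     if refining l y \<in> s k then Some (cs @ [C k (refining l y) (l y)]) else None)"

definition block where "block C s k = refining (location k (run C s k))"

definition alive where "alive C s k = {y. run C s k y \<noteq> None}"

text \<open>For fixed \<open>C\<close>, \<open>s\<close> and \<open>k\<close>, the pieces with
  \<open>q < 3 * m\<close> form the sparse collection to which the shattering property is
  applied.\<close>

definition piece where "piece C s k q = {y \<in> alive C s k. block C s k y = q}"

lemma location_less: "location k h y < m"
  using m by (auto simp: location_def split: option.split)

lemma block_less: "y \<in> V \<Longrightarrow> block C s k y < 3 * m"
  unfolding block_def by (rule refining(1)) (auto simp: location_less)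

lemma alive_0: "alive C s 0 = V"
  by (auto simp: alive_def)

lemma alive_Suc: "alive C s (Suc k) = {y \<in> alive C s k. block C s k y \<in> s k}"
  by (auto simp: alive_def block_def Let_def split: option.splits)

lemma alive_subset: "alive C s k \<subseteq> V"
  by (induction k) (auto simp: alive_0 alive_Suc)

text \<open>Step \<open>j\<close> uses only the sample of table \<open>j\<close>, so the state
  before step \<open>k\<close> is independent of the sample of table \<open>k\<close>.\<close>

lemma run_cong: "(\<And>j. j < k \<Longrightarrow> s j = s' j) \<Longrightarrow> run C s k = run C s' k"
proof (induction k)
  case (Suc k)
  then have "run C s k = run C s' k" "s k = s' k" by simp_all
  then show ?case by (simp only: run.simps)
qed simp

lemma disjoint_pieces: "disjoint_family_on (piece C s k) I"
  by (auto simp: disjoint_family_on_def piece_def)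

lemma UN_pieces: "(\<Union>q<3 * m. piece C s k q) = alive C s k"
  using block_less alive_subset by (fastforce simp: piece_def)

lemma UN_chosen_pieces: "(\<Union>q\<in>s k. piece C s k q) = alive C s (Suc k)"
  by (auto simp: piece_def alive_Suc)

lemma prob_piece_le: "measure_pmf.prob (nu e) (piece C s k q) \<le> 1 / real m"
proof -
  have "measure_pmf.prob (nu e) (piece C s k q)
      \<le> measure_pmf.prob (nu e) {y \<in> V. block C s k y = q}"
    using alive_subset by (intro measure_pmf.finite_measure_mono) (auto simp: piece_def)
  also have "\<dots> \<le> 1 / real m"
    unfolding block_def by (rule refining(3)) (auto simp: location_less)
  finally show ?thesis .
qed

section \<open>Shattered points and the mass that survives there\<close>

definition shattered where
  "shattered C s x \<longleftrightarrow> (\<forall>k<t. weakly_shatters e K (\<gamma> / real t) (3 * m) (piece C s k) x)"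

text \<open>The shattering property fails with probability at most \<open>\<gamma> / t\<close> at
  each step, and a union bound covers the \<open>t\<close> steps. Contents and sample are fixed
  before \<open>x\<close> is drawn.\<close>

lemma prob_not_shattered: "measure_pmf.prob (mu e) {x. \<not> shattered C s x} \<le> \<gamma>"
proof -
  let ?bad = "\<lambda>k. {x. \<not> weakly_shatters e K (\<gamma> / real t) (3 * m) (piece C s k) x}"
  have "measure_pmf.prob (mu e) (?bad k) \<le> \<gamma> / t" for k
  proof -
    have "\<forall>i<3 * m. piece C s k i \<subseteq> V"
      using alive_subset by (auto simp: piece_def)
    then have "1 - \<gamma> / t \<le> measure_pmf.prob (mu e) (- ?bad k)"
      using shattering disjoint_pieces prob_piece_le
      unfolding weak_shattering_property_def sparse_collection_def by (auto simp: Compl_eq)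
    then show ?thesis
      by (subst (asm) measure_pmf.prob_compl[of _ "mu e", simplified, folded Compl_eq_Diff_UNIV]) auto
  qed
  then have "(\<Sum>k<t. measure_pmf.prob (mu e) (?bad k)) \<le> (\<Sum>k<t. \<gamma> / t)"
    by (intro sum_mono) auto
  moreover have "measure_pmf.prob (mu e) (\<Union>k<t. ?bad k) \<le> (\<Sum>k<t. measure_pmf.prob (mu e) (?bad k))"
    by (intro measure_UNION_le) auto
  moreover have "{x. \<not> shattered C s x} = (\<Union>k<t. ?bad k)"
    by (auto simp: shattered_def)
  ultimately show ?thesis using t by simp
qed

text \<open>Capping at \<open>1 / K\<close> loses little mass at a shattered point and bounds the variance of the sampled
  mass.\<close>

definition capped where
  "capped C s k x q = min (measure_pmf.prob (nu_at e x) (piece C s k q)) (1 / K)"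

text \<open>The sampling error of step \<open>k\<close>: sampled capped mass minus its mean, in
  units of the survival rate \<open>p ^ Suc k\<close>.\<close>

definition deviation where
  "deviation C s k x =
     ((\<Sum>q\<in>s k. capped C s k x q) - p * (\<Sum>q<3 * m. capped C s k x q)) / p ^ Suc k"

text \<open>Rescaled so that the average over all samples is \<open>1\<close> at every step.\<close>

abbreviation mass where
  "mass r C s k \<equiv> measure_pmf.prob r (alive C s k) / p ^ k"

text \<open>Capping costs at most \<open>\<gamma> / t\<close> times the \<nu>-mass of the live
  queries, by shattering; sampling the capped pieces costs the deviation.\<close>

lemma mass_step:
  assumes s: "s k \<subseteq> {..<3 * m}"
    and sh: "weakly_shatters e K (\<gamma> / real t) (3 * m) (piece C s k) x"
  shows "mass (nu_at e x) C s (Suc k) \<ge>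
    mass (nu_at e x) C s k - \<gamma> / t * mass (nu e) C s k - \<bar>deviation C s k x\<bar>"
proof -
  let ?P = "\<lambda>q. measure_pmf.prob (nu_at e x) (piece C s k q)"
  have "?P q = capped C s k x q + max (?P q - 1 / K) 0" for q
    by (auto simp: capped_def)
  then have "(\<Sum>q<3 * m. ?P q) = (\<Sum>q<3 * m. capped C s k x q) + (\<Sum>q<3 * m. max (?P q - 1 / K) 0)"
    by (simp add: sum.distrib[symmetric])
  also have "\<dots> \<le> (\<Sum>q<3 * m. capped C s k x q) + \<gamma> / t * measure_pmf.prob (nu e) (alive C s k)"
    using sh unfolding weakly_shatters_def UN_pieces by simp
  finally have 1: "measure_pmf.prob (nu_at e x) (alive C s k) - \<gamma> / t * measure_pmf.prob (nu e) (alive C s k)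
      \<le> (\<Sum>q<3 * m. capped C s k x q)"
    by (simp add: prob_finite_UN_sum[OF _ disjoint_pieces, symmetric] UN_pieces)
  have "p * (\<Sum>q<3 * m. capped C s k x q) + p ^ Suc k * deviation C s k x = (\<Sum>q\<in>s k. capped C s k x q)"
    using p by (simp add: deviation_def)
  also have "\<dots> \<le> (\<Sum>q\<in>s k. ?P q)"
    by (intro sum_mono) (simp add: capped_def)
  also have "\<dots> = measure_pmf.prob (nu_at e x) (alive C s (Suc k))"
    using s finite_subset by (subst prob_finite_UN_sum[OF _ disjoint_pieces, symmetric])
      (auto simp: UN_chosen_pieces)
  finally have "p * (measure_pmf.prob (nu_at e x) (alive C s k) - \<gamma> / t * measure_pmf.prob (nu e) (alive C s k))
      + p ^ Suc k * deviation C s k x \<le> measure_pmf.prob (nu_at e x) (alive C s (Suc k))"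
    using mult_left_mono[OF 1, of p] p by linarith
  then have "(p * (measure_pmf.prob (nu_at e x) (alive C s k) - \<gamma> / t * measure_pmf.prob (nu e) (alive C s k))
      + p ^ Suc k * deviation C s k x) / p ^ Suc k \<le> mass (nu_at e x) C s (Suc k)"
    using p by (intro divide_right_mono) auto
  moreover have "(p * (measure_pmf.prob (nu_at e x) (alive C s k) - \<gamma> / t * measure_pmf.prob (nu e) (alive C s k))
      + p ^ Suc k * deviation C s k x) / p ^ Suc k
    = mass (nu_at e x) C s k - \<gamma> / t * mass (nu e) C s k + deviation C s k x"
    using p by (simp add: add_divide_distrib diff_divide_distrib)
  ultimately show ?thesis by linarith
qed

text \<open>The losses of \<open>mass_step\<close> add up, starting from mass \<open>1\<close>
  because \<nu>-mass at \<open>x\<close> is carried by \<open>V\<close>.\<close>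

lemma mass_lower_bound:
  assumes x: "x \<in> set_pmf (mu e)" and s: "\<And>k. k < t \<Longrightarrow> s k \<subseteq> {..<3 * m}" and sh: "shattered C s x"
  shows "mass (nu_at e x) C s t \<ge>
    1 - (\<Sum>k<t. \<gamma> / t * mass (nu e) C s k) - (\<Sum>k<t. \<bar>deviation C s k x\<bar>)"
proof -
  have "mass (nu_at e x) C s j \<ge>
    1 - (\<Sum>k<j. \<gamma> / t * mass (nu e) C s k) - (\<Sum>k<j. \<bar>deviation C s k x\<bar>)" if "j \<le> t" for j
    using that
  proof (induction j)
    case 0
    have "measure_pmf.prob (nu_at e x) V = 1"
      using set_nu_at_V[OF x] by (simp add: measure_pmf.prob_eq_1 AE_measure_pmf_iff subset_iff)
    then show ?case by (simp add: alive_0)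
  next
    case (Suc j)
    then show ?case
      using mass_step[of s j C x] s[of j] sh by (simp add: shattered_def)
  qed
  then show ?thesis by simp
qed

section \<open>Moments over random samples\<close>

abbreviation samples where "samples \<equiv> replicate_pmf t (random_subset p (3 * m))"

lemma finite_samples [simp]: "finite (set_pmf samples)"
  by (simp add: finite_replicate_pmf)

lemma samples_nth_subset: "Ss \<in> set_pmf samples \<Longrightarrow> k < t \<Longrightarrow> Ss ! k \<subseteq> {..<3 * m}"
  using subsetD[OF set_random_subset[of p "3 * m"], of "Ss ! k"] nth_mem[of k Ss]
  by (auto simp: set_replicate_pmf in_lists_conv_set)

lemma run_update: "run C ((!) (Ss[k := S])) k = run C ((!) Ss) k"
  by (rule run_cong) simp

lemma alive_update: "alive C ((!) (Ss[k := S])) k = alive C ((!) Ss) k"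
  and block_update: "block C ((!) (Ss[k := S])) k = block C ((!) Ss) k"
  by (simp_all only: alive_def block_def run_update)

text \<open>The virtual cell that \<open>y\<close> probes in table \<open>k\<close> is determined by
  the earlier samples, so a fresh sample of table \<open>k\<close> contains it with probability
  \<open>p\<close>.\<close>

lemma avg_alive:
  assumes "y \<in> V" "k \<le> t"
  shows "avg samples (\<lambda>Ss. indicator (alive C ((!) Ss) k) y) = p ^ k"
  using assms(2)
proof (induction k)
  case 0
  then show ?case using assms by (simp add: alive_0 avg_const)
next
  case (Suc k)
  have "avg samples (\<lambda>Ss. indicator (alive C ((!) Ss) (Suc k)) y) =
    avg samples (\<lambda>Ss. avg (random_subset p (3 * m))
      (\<lambda>S. indicator (alive C ((!) (Ss[k := S])) (Suc k)) y))"
    using Suc.prems by (intro avg_resample) auto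
  also have "\<dots> = avg samples (\<lambda>Ss. avg (random_subset p (3 * m))
      (\<lambda>S. indicator (alive C ((!) Ss) k) y * (if block C ((!) Ss) k y \<in> S then 1 else 0)))"
    using Suc.prems
    by (intro avg_cong)
       (auto simp: alive_Suc alive_update block_update indicator_def set_replicate_pmf)
  also have "\<dots> = avg samples (\<lambda>Ss. indicator (alive C ((!) Ss) k) y * p)"
    using p block_less[OF assms(1)] by (simp add: avg_cmult prob_mem_random_subset)
  also have "\<dots> = p ^ Suc k"
    using Suc by (simp add: avg_multc)
  finally show ?case .
qed

text \<open>Every query survives at the same rate, so survival favours no fixed set
  \<open>B\<close>; the wrongly answered queries are the main case.\<close>

lemma avg_prob_alive_Int:
  assumes "k \<le> t" "set_pmf r \<subseteq> V"
  shows "avg samples (\<lambda>Ss. measure_pmf.prob r (alive C ((!) Ss) k \<inter> B)) = p ^ k * measure_pmf.prob r B"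
proof -
  have fr: "finite (set_pmf r)" using assms finite_V finite_subset by blast
  have "avg samples (\<lambda>Ss. measure_pmf.prob r (alive C ((!) Ss) k \<inter> B)) =
    avg r (\<lambda>y. avg samples (\<lambda>Ss. indicator (alive C ((!) Ss) k) y * indicator B y))"
    unfolding prob_eq_avg[OF fr] indicator_inter_arith by (rule avg_swap)
  also have "\<dots> = avg r (\<lambda>y. p ^ k * indicator B y)"
    unfolding avg_multc using assms by (intro avg_cong) (auto simp: avg_alive)
  also have "\<dots> = p ^ k * measure_pmf.prob r B"
    by (simp add: avg_cmult prob_eq_avg[OF fr])
  finally show ?thesis .
qed

lemma avg_mass:
  assumes "k \<le> t" "set_pmf r \<subseteq> V"
  shows "avg samples (\<lambda>Ss. mass r C ((!) Ss) k) = 1"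
  using avg_prob_alive_Int[OF assms, of C UNIV] p by (simp add: avg_divide)

text \<open>One factor is bounded by the cap, the other sums to at most the live mass.\<close>

lemma sum_capped_squares:
  "(\<Sum>q<3 * m. (capped C s k x q)\<^sup>2) \<le> measure_pmf.prob (nu_at e x) (alive C s k) / K"
proof -
  have "(\<Sum>q<3 * m. (capped C s k x q)\<^sup>2) \<le> (\<Sum>q<3 * m. measure_pmf.prob (nu_at e x) (piece C s k q) * (1 / K))"
    unfolding power2_eq_square using K
    by (intro sum_mono mult_mono) (auto simp: capped_def min_def)
  also have "\<dots> = measure_pmf.prob (nu_at e x) (alive C s k) / K"
    by (simp add: prob_finite_UN_sum[OF _ disjoint_pieces, symmetric] UN_pieces
        sum_divide_distrib[symmetric])
  finally show ?thesis .
qed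

text \<open>With the other samples fixed, redrawing table \<open>k\<close> gives the variance of a
  random subset sum; the remaining live mass averages to \<open>p ^ k\<close>.\<close>

lemma avg_deviation_square:
  assumes "k < t" "x \<in> set_pmf (mu e)"
  shows "avg samples (\<lambda>Ss. (deviation C ((!) Ss) k x)\<^sup>2) \<le> (1 - p) / (K * p ^ Suc k)"
proof -
  let ?c = "\<lambda>Ss. capped C ((!) Ss) k x"
  have "avg samples (\<lambda>Ss. (deviation C ((!) Ss) k x)\<^sup>2) =
    avg samples (\<lambda>Ss. avg (random_subset p (3 * m)) (\<lambda>S. (deviation C ((!) (Ss[k := S])) k x)\<^sup>2))"
    using assms by (intro avg_resample) auto
  also have "\<dots> = avg samples (\<lambda>Ss. avg (random_subset p (3 * m))
      (\<lambda>S. ((\<Sum>q\<in>S. ?c Ss q) - p * (\<Sum>q<3 * m. ?c Ss q))\<^sup>2) / (p ^ Suc k)\<^sup>2)"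
    unfolding avg_divide[symmetric] using assms
    by (intro avg_cong)
       (auto simp: deviation_def capped_def piece_def alive_update block_update
          power_divide set_replicate_pmf)
  also have "\<dots> = avg samples (\<lambda>Ss. p * (1 - p) * (\<Sum>q<3 * m. (?c Ss q)\<^sup>2) / (p ^ Suc k)\<^sup>2)"
    using p by (simp add: variance_random_subset)
  also have "\<dots> \<le> avg samples (\<lambda>Ss. p * (1 - p) *
      (measure_pmf.prob (nu_at e x) (alive C ((!) Ss) k) / K) / (p ^ Suc k)\<^sup>2)"
    using p by (intro avg_mono divide_right_mono mult_left_mono sum_capped_squares) auto
  also have "\<dots> = avg samples (\<lambda>Ss. (1 - p) / (K * p ^ Suc k) * mass (nu_at e x) C ((!) Ss) k)"
    using p by (intro avg_cong) (simp add: power2_eq_square)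
  also have "\<dots> = (1 - p) / (K * p ^ Suc k)"
    unfolding avg_cmult using assms by (simp add: avg_mass set_nu_at_V)
  finally show ?thesis .
qed

text \<open>\<open>K_large\<close> bounds the second moment of each deviation by the square of
  \<open>\<delta> / t\<close>. For \<open>p = 1\<close> every cell is kept and there is no
  deviation.\<close>

lemma avg_deviation:
  assumes \<delta>: "0 < \<delta>" and K_large: "p = 1 \<or> (t / \<delta>)\<^sup>2 \<le> K * p ^ t" and x: "x \<in> set_pmf (mu e)"
  shows "avg samples (\<lambda>Ss. \<Sum>k<t. \<bar>deviation C ((!) Ss) k x\<bar>) \<le> 2 * \<delta>"
proof -
  have "avg samples (\<lambda>Ss. \<bar>deviation C ((!) Ss) k x\<bar>) \<le> 2 * \<delta> / t" if k: "k < t" for k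
  proof -
    have var: "(1 - p) / (K * p ^ Suc k) \<le> (\<delta> / t)\<^sup>2"
    proof (cases "p = 1")
      case False
      have "p ^ t \<le> p ^ Suc k" using k p by (intro power_decreasing) auto
      then have *: "(t / \<delta>)\<^sup>2 \<le> K * p ^ Suc k"
        using K_large False order_trans[OF _ mult_left_mono[of "p ^ t" "p ^ Suc k" K]] K by auto
      have "(1 - p) / (K * p ^ Suc k) \<le> 1 / (t / \<delta>)\<^sup>2"
        using * p t \<delta> by (intro frac_le) auto
      then show ?thesis using t \<delta> by (simp add: power_divide)
    qed simp
    \<comment> \<open>This replaces the Cauchy-Schwarz inequality at the price of a factor
      \<open>2\<close>: with a second moment of \<open>(\<delta> / t)\<^sup>2\<close>, both terms
      average to \<open>\<delta> / t\<close>.\<close>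
    have AM: "\<bar>z\<bar> \<le> \<delta> / t + (t / \<delta>) * z\<^sup>2" for z :: real
    proof -
      define l where "l = \<delta> / t"
      have l: "0 < l" using \<delta> t by (simp add: l_def)
      have "l * \<bar>z\<bar> \<le> l\<^sup>2 + \<bar>z\<bar>\<^sup>2"
        using zero_le_power2[of "l - \<bar>z\<bar>"] mult_nonneg_nonneg[of l "\<bar>z\<bar>"] l
        unfolding power2_diff by linarith
      then have "\<bar>z\<bar> \<le> l + z\<^sup>2 / l"
        using l by (simp add: field_simps power2_eq_square)
      then show ?thesis by (simp add: l_def mult.commute)
    qed
    have "avg samples (\<lambda>Ss. \<bar>deviation C ((!) Ss) k x\<bar>) \<le>
      avg samples (\<lambda>Ss. \<delta> / t + (t / \<delta>) * (deviation C ((!) Ss) k x)\<^sup>2)"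
      by (intro avg_mono AM)
    also have "\<dots> \<le> \<delta> / t + (t / \<delta>) * (\<delta> / t)\<^sup>2"
      unfolding avg_add avg_cmult using avg_deviation_square[OF k x, of C] var \<delta> t
      by (intro add_mono mult_left_mono) (auto simp: avg_const)
    also have "\<dots> = 2 * \<delta> / t"
      using t \<delta> by (simp add: power2_eq_square field_simps)
    finally show ?thesis .
  qed
  then have "(\<Sum>k<t. avg samples (\<lambda>Ss. \<bar>deviation C ((!) Ss) k x\<bar>)) \<le> (\<Sum>k<t. 2 * \<delta> / t)"
    by (intro sum_mono) auto
  then show ?thesis using t by (simp add: avg_sum)
qed

section \<open>Recovering the database from the sampled cells\<close>

definition truth where "truth db k q l = table D db k l"

definition valid_db where "valid_db db \<longleftrightarrow> length db = n \<and> fst ` set db \<subseteq> U"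

lemma length_table: "valid_db db \<Longrightarrow> k < t \<Longrightarrow> j < m \<Longrightarrow> length (table D db k j) = w"
  using tables unfolding cell_probe_structure_def valid_db_def by blast

text \<open>True contents are words of length \<open>w\<close>, so every probe is below
  \<open>m\<close> and the reduction in \<open>location\<close> changes nothing: a surviving run is
  the actual run.\<close>

lemma run_truth:
  assumes "valid_db db" "k \<le> t" "run (truth db) s k y = Some cs"
  shows "cs = cells_read D db y k \<and> length cs = k \<and> (\<forall>c\<in>set cs. length c = w)"
  using assms(2,3)
proof (induction k arbitrary: cs)
  case 0
  then show ?case by (auto split: if_splits)
next
  case (Suc k)
  from Suc.prems(2) obtain cs' where cs': "run (truth db) s k y = Some cs'"
    by (auto split: option.splits)
  have IH: "cs' = cells_read D db y k" "length cs' = k" "\<forall>c\<in>set cs'. length c = w"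
    using Suc.IH[OF _ cs'] Suc.prems(1) by auto
  have "y \<in> V"
    using alive_subset[of "truth db" s k] cs' by (auto simp: alive_def)
  then have probe: "probe D k y cs' < m"
    using tables IH Suc.prems(1) unfolding cell_probe_structure_def by (metis Suc_le_eq)
  then have "cs = cs' @ [table D db k (probe D k y cs')]"
    using Suc.prems(2) by (auto simp: cs' Let_def location_def split: if_splits) (simp add: truth_def)
  then show ?case
    using IH length_table[OF assms(1) _ probe] Suc.prems(1) by (auto simp: Let_def)
qed

text \<open>All queries served by one virtual cell read the same real cell, so one word per sampled
  virtual cell reproduces the run. This bounds the number of possible runs for the union
  bound.\<close>

lemma contents_code:
  assumes "valid_db db"
  obtains \<sigma> where "\<sigma> \<in> Pi\<^sub>E (SIGMA k:{..<t}. s k) (\<lambda>_. {bs. length bs = w})"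
    "\<And>k. k \<le> t \<Longrightarrow> run (\<lambda>k q l. \<sigma> (k, q)) s k = run (truth db) s k"
proof -
  define loc where "loc k = location k (run (truth db) s k)" for k
  \<comment> \<open>Any query served by virtual cell \<open>q\<close>. If there is none,
    \<open>rep\<close> is arbitrary, but its location is still below \<open>m\<close>, so the stored
    word has length \<open>w\<close>.\<close>
  define rep where "rep k q = (SOME y. y \<in> V \<and> refining (loc k) y = q)" for k q
  define \<sigma> where "\<sigma> = (\<lambda>(k, q)\<in>(SIGMA k:{..<t}. s k). table D db k (loc k (rep k q)))"
  have loc_less: "loc k y < m" for k y by (simp add: loc_def location_less)
  have rep: "loc k (rep k (refining (loc k) y)) = loc k y" if "y \<in> V" for k y
  proof -
    have "rep k (refining (loc k) y) \<in> V \<and> refining (loc k) (rep k (refining (loc k) y)) = refining (loc k) y"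
      unfolding rep_def by (rule someI[of _ y]) (simp add: that)
    then show ?thesis using refining(2)[of "loc k"] loc_less that by blast
  qed
  show thesis
  proof (rule that[of \<sigma>])
    show "\<sigma> \<in> Pi\<^sub>E (SIGMA k:{..<t}. s k) (\<lambda>_. {bs. length bs = w})"
      using length_table[OF assms] loc_less by (auto simp: \<sigma>_def)
  next
    fix k assume "k \<le> t"
    then show "run (\<lambda>k q l. \<sigma> (k, q)) s k = run (truth db) s k"
    proof (induction k)
      case (Suc k)
      then have IH: "run (\<lambda>k q l. \<sigma> (k, q)) s k = run (truth db) s k" by simp
      show ?case
      proof
        fix y
        have "y \<in> V" if "run (truth db) s k y = Some cs" for cs
          using alive_subset[of "truth db" s k] that by (auto simp: alive_def)
        then show "run (\<lambda>k q l. \<sigma> (k, q)) s (Suc k) y = run (truth db) s (Suc k) y"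
          unfolding run.simps IH loc_def[symmetric] Let_def
          using Suc.prems rep[of y k]
          by (auto simp: truth_def \<sigma>_def split: option.split)
      qed
    qed simp
  qed
qed

lemma shattered_cong:
  assumes "\<And>k. k \<le> t \<Longrightarrow> run C s k = run C' s k"
  shows "shattered C s x = shattered C' s x"
  using assms by (simp add: shattered_def piece_def[abs_def] alive_def block_def)

section \<open>Decoding a bit by majority vote\<close>

definition answer_mass where
  "answer_mass C s x a =
     measure_pmf.prob (nu_at e x) {y \<in> alive C s t. answer_fun D y (the (run C s t y)) = a}"

text \<open>The majority answer, with ties decided as \<open>False\<close>. The database enters only
  through the contents \<open>C\<close>.\<close>

definition guess where
  "guess C s x \<longleftrightarrow> answer_mass C s x False < answer_mass C s x True"

lemma guess_cong: "run C s t = run C' s t \<Longrightarrow> guess C s x = guess C' s x"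
  by (simp add: guess_def answer_mass_def alive_def)

definition wrong where "wrong db b = {y. run_query D t db y \<noteq> b}"

text \<open>On true contents the surviving queries give their actual answers, so fewer than half of
  the votes are wrong.\<close>

lemma guess_eqI:
  assumes db: "valid_db db"
    and less: "2 * measure_pmf.prob (nu_at e x) (alive (truth db) s t \<inter> wrong db b)
      < measure_pmf.prob (nu_at e x) (alive (truth db) s t)"
  shows "guess (truth db) s x = b"
proof -
  let ?A = "alive (truth db) s t" and ?P = "measure_pmf.prob (nu_at e x)"
  have "{y \<in> ?A. answer_fun D y (the (run (truth db) s t y)) = a} = ?A \<inter> wrong db (\<not> a)" for a
    using run_truth[OF db order_refl, of s] by (fastforce simp: alive_def wrong_def run_query_def)
  then have am: "answer_mass (truth db) s x a = ?P (?A \<inter> wrong db (\<not> a))" for a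
    by (simp add: answer_mass_def)
  have "?A = (?A \<inter> wrong db b) \<union> (?A \<inter> wrong db (\<not> b))"
    by (auto simp: wrong_def)
  then have "?P ?A \<le> ?P (?A \<inter> wrong db b) + ?P (?A \<inter> wrong db (\<not> b))"
    using measure_Un_le[of "?A \<inter> wrong db b" "nu_at e x" "?A \<inter> wrong db (\<not> b)"] by simp
  then show ?thesis using less by (cases b) (auto simp: guess_def am)
qed

text \<open>At a shattered point, \<open>loss < 1\<close> forces a correct guess; on average the loss is small.\<close>

definition loss where
  "loss db s x b =
     8 * (\<Sum>k<t. \<gamma> / t * mass (nu e) (truth db) s k) + 8 * (\<Sum>k<t. \<bar>deviation (truth db) s k x\<bar>)
     + 4 * (measure_pmf.prob (nu_at e x) (alive (truth db) s t \<inter> wrong db b) / p ^ t)"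

lemma loss_nonneg: "0 \<le> \<gamma> \<Longrightarrow> 0 \<le> loss db s x b"
  using p by (auto simp: loss_def intro!: add_nonneg_nonneg sum_nonneg)

lemma guess_correct:
  assumes "0 \<le> \<gamma>" "valid_db db" "x \<in> set_pmf (mu e)" "\<And>k. k < t \<Longrightarrow> s k \<subseteq> {..<3 * m}"
    "shattered (truth db) s x" "loss db s x b < 1"
  shows "guess (truth db) s x = b"
proof (rule guess_eqI[OF assms(2)])
  let ?W = "measure_pmf.prob (nu_at e x) (alive (truth db) s t \<inter> wrong db b) / p ^ t"
  have "0 \<le> (\<Sum>k<t. \<gamma> / t * mass (nu e) (truth db) s k)" "0 \<le> (\<Sum>k<t. \<bar>deviation (truth db) s k x\<bar>)"
    "0 \<le> ?W"
    using p assms(1) by (auto intro!: sum_nonneg)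
  \<comment> \<open>A loss below \<open>1\<close> keeps the two sums together below
    \<open>1 / 8\<close> and \<open>?W\<close> below \<open>1 / 4\<close>, so the mass exceeds
    \<open>7 / 8\<close> while \<open>2 * ?W\<close> is below \<open>1 / 2\<close>.\<close>
  then have "2 * ?W < mass (nu_at e x) (truth db) s t"
    using mass_lower_bound[OF assms(3,4,5)] assms(6) unfolding loss_def by linarith
  then show "2 * measure_pmf.prob (nu_at e x) (alive (truth db) s t \<inter> wrong db b)
      < measure_pmf.prob (nu_at e x) (alive (truth db) s t)"
    using p by (simp add: divide_less_cancel)
qed

text \<open>The masses average to \<open>1\<close>, the deviations are small on average, and wrong
  queries survive at rate exactly \<open>p ^ t\<close>.\<close>

lemma avg_loss:
  assumes "0 < \<delta>" "p = 1 \<or> (t / \<delta>)\<^sup>2 \<le> K * p ^ t" "x \<in> set_pmf (mu e)"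
  shows "avg samples (\<lambda>Ss. loss db ((!) Ss) x b)
    \<le> 8 * \<gamma> + 16 * \<delta> + 4 * measure_pmf.prob (nu_at e x) (wrong db b)"
proof -
  have "avg samples (\<lambda>Ss. \<Sum>k<t. \<gamma> / t * mass (nu e) (truth db) ((!) Ss) k) = (\<Sum>k<t. \<gamma> / t)"
    unfolding avg_sum avg_cmult by (intro sum.cong) (auto simp: avg_mass set_nu)
  also have "\<dots> = \<gamma>" using t by simp
  finally show ?thesis
    unfolding loss_def avg_add avg_cmult avg_divide
    using avg_deviation[OF assms, of "truth db"] p
    by (simp add: avg_prob_alive_Int set_nu_at_V[OF assms(3)])
qed

section \<open>Random databases and the average error\<close>

abbreviation coin :: "bool pmf" where "coin \<equiv> pmf_of_set UNIV"

abbreviation databases where "databases \<equiv> replicate_pmf n (pair_pmf (mu e) coin)"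

lemma finite_entry [simp]: "finite (set_pmf (pair_pmf (mu e) coin))"
  by simp

lemma finite_databases [simp]: "finite (set_pmf databases)"
  by (simp only: finite_replicate_pmf finite_entry)

lemma databasesD:
  assumes "db \<in> set_pmf databases"
  shows "valid_db db" "length db = n" "i < n \<Longrightarrow> fst (db ! i) \<in> set_pmf (mu e)"
proof -
  have db: "length db = n" "set db \<subseteq> set_pmf (mu e) \<times> UNIV"
    using assms by (auto simp: set_replicate_pmf in_lists_conv_set)
  then show "valid_db db" "length db = n" using set_mu by (auto simp: valid_db_def)
  show "fst (db ! i) \<in> set_pmf (mu e)" if "i < n"
    using db that subsetD[OF db(2) nth_mem[of i db]] by (simp add: mem_Times_iff)
qed

lemma gns_distribution_eq:
  "gns_distribution e n =
     do {db \<leftarrow> databases; i \<leftarrow> pmf_of_set {..<n}; y \<leftarrow> nu_at e (fst (db ! i)); return_pmf (db, y)}"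
  if "0 < n"
proof -
  have "set_pmf (pmf_of_set {..<n}) = {..<n}"
    using that by (intro set_pmf_of_set) auto
  then show ?thesis
    unfolding gns_distribution_def replicate_pmf_pair
    by (simp only: bind_assoc_pmf bind_return_pmf, intro bind_pmf_cong refl)
       (auto simp: set_replicate_pmf)
qed

lemma success_probability_eq:
  assumes "0 < n"
  shows "success_probability E e n t D = avg databases (\<lambda>db. (\<Sum>i<n.
     measure_pmf.prob (nu_at e (fst (db ! i))) {y. correct_answer E db y (run_query D t db y)}) / n)"
proof -
  let ?S = "{(db, y). correct_answer E db y (run_query D t db y)}"
  have ne: "{..<n} \<noteq> {}" using assms by auto
  have fin: "finite (set_pmf (pmf_of_set {..<n} \<bind> (\<lambda>i. nu_at e (fst (db ! i)) \<bind> (\<lambda>y. return_pmf (db, y)))))"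
    if "db \<in> set_pmf databases" for db
    using ne databasesD(3)[OF that] finite_nu_at by auto
  have "success_probability E e n t D = avg (gns_distribution e n) (indicator ?S)"
    unfolding success_probability_def gns_distribution_eq[OF assms]
    using fin by (intro prob_eq_avg) (auto simp del: set_replicate_pmf set_pair_pmf)
  also have "\<dots> = avg databases (\<lambda>db. avg (pmf_of_set {..<n} \<bind>
      (\<lambda>i. nu_at e (fst (db ! i)) \<bind> (\<lambda>y. return_pmf (db, y)))) (indicator ?S))"
    unfolding gns_distribution_eq[OF assms] using fin by (intro avg_bind) auto
  also have "\<dots> = avg databases (\<lambda>db. (\<Sum>i<n.
     measure_pmf.prob (nu_at e (fst (db ! i))) {y. correct_answer E db y (run_query D t db y)}) / n)"
  proof (rule avg_cong)
    fix db assume db: "db \<in> set_pmf databases"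
    have "avg (pmf_of_set {..<n} \<bind> (\<lambda>i. nu_at e (fst (db ! i)) \<bind> (\<lambda>y. return_pmf (db, y)))) (indicator ?S)
      = avg (pmf_of_set {..<n}) (\<lambda>i. avg (nu_at e (fst (db ! i)) \<bind> (\<lambda>y. return_pmf (db, y))) (indicator ?S))"
      using ne databasesD(3)[OF db] finite_nu_at by (intro avg_bind) auto
    also have "\<dots> = (\<Sum>i<n. avg (nu_at e (fst (db ! i)) \<bind> (\<lambda>y. return_pmf (db, y))) (indicator ?S)) / n"
      using ne by (simp add: avg_pmf_of_set)
    also have "(\<Sum>i<n. avg (nu_at e (fst (db ! i)) \<bind> (\<lambda>y. return_pmf (db, y))) (indicator ?S)) =
      (\<Sum>i<n. measure_pmf.prob (nu_at e (fst (db ! i))) {y. correct_answer E db y (run_query D t db y)})"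
    proof (rule sum.cong[OF refl])
      fix i assume "i \<in> {..<n}"
      then have f: "finite (set_pmf (nu_at e (fst (db ! i))))"
        using databasesD(3)[OF db] finite_nu_at by auto
      show "avg (nu_at e (fst (db ! i)) \<bind> (\<lambda>y. return_pmf (db, y))) (indicator ?S) =
        measure_pmf.prob (nu_at e (fst (db ! i))) {y. correct_answer E db y (run_query D t db y)}"
        unfolding prob_eq_avg[OF f] using f by (subst avg_bind) (auto simp: indicator_def intro!: avg_cong)
    qed
    finally show "avg (pmf_of_set {..<n} \<bind> (\<lambda>i. nu_at e (fst (db ! i)) \<bind> (\<lambda>y. return_pmf (db, y)))) (indicator ?S)
      = (\<Sum>i<n. measure_pmf.prob (nu_at e (fst (db ! i))) {y. correct_answer E db y (run_query D t db y)}) / n" .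
  qed
  finally show ?thesis .
qed

text \<open>Points at distinct positions are independent draws from \<mu>, which is the setting of
  weak independence.\<close>

lemma avg_collision:
  assumes "weak_independence E e \<gamma> n" "i < n" "j < n" "i \<noteq> j"
  shows "avg databases (\<lambda>db. measure_pmf.prob (nu_at e (fst (db ! i))) {y. (fst (db ! j), y) \<in> E}) \<le> \<gamma> / n"
proof -
  let ?F = "\<lambda>x z. measure_pmf.prob (nu_at e x) {y. (z, y) \<in> E}"
  have "avg databases (\<lambda>db. ?F (fst (db ! i)) (fst (db ! j))) =
    avg (pair_pmf (mu e) coin) (\<lambda>a. avg (pair_pmf (mu e) coin) (\<lambda>b. ?F (fst a) (fst b)))"
    using assms by (intro avg_two_coordinates[where f = "\<lambda>a b. ?F (fst a) (fst b)"]) auto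
  also have "\<dots> = avg (mu e) (\<lambda>x. avg (mu e) (\<lambda>z. ?F x z))"
    by (simp add: avg_pair avg_const)
  also have "\<dots> = measure_pmf.prob
      (do {x \<leftarrow> mu e; z \<leftarrow> mu e; y \<leftarrow> nu_at e x; return_pmf (z, y)}) E"
  proof -
    have "measure_pmf.prob (do {x \<leftarrow> mu e; z \<leftarrow> mu e; y \<leftarrow> nu_at e x; return_pmf (z, y)}) E =
      avg (do {x \<leftarrow> mu e; z \<leftarrow> mu e; y \<leftarrow> nu_at e x; return_pmf (z, y)}) (indicator E)"
      by (rule prob_eq_avg) (auto simp: finite_nu_at)
    also have "\<dots> = avg (mu e) (\<lambda>x. avg (mu e) (\<lambda>z. avg (nu_at e x) (\<lambda>y. indicator E (z, y))))"
      by (auto simp: avg_bind finite_nu_at intro!: avg_cong)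
    also have "\<dots> = avg (mu e) (\<lambda>x. avg (mu e) (\<lambda>z. ?F x z))"
      by (intro avg_cong) (auto simp: prob_eq_avg finite_nu_at indicator_def intro!: avg_cong)
    finally show ?thesis by simp
  qed
  also have "\<dots> \<le> \<gamma> / n" using assms(1) unfolding weak_independence_def .
  finally show ?thesis .
qed

text \<open>A query drawn at \<open>x\<close> is adjacent to \<open>x\<close>. Unless another
  database point is adjacent too, \<open>x\<close> is its unique neighbour and a correct answer must
  be the stored bit.\<close>

lemma prob_wrong_le:
  assumes db: "db \<in> set_pmf databases" and i: "i < n"
  shows "measure_pmf.prob (nu_at e (fst (db ! i))) (wrong db (snd (db ! i)))
    \<le> (1 - measure_pmf.prob (nu_at e (fst (db ! i))) {y. correct_answer E db y (run_query D t db y)})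
      + (\<Sum>j\<in>{..<n} - {i}. measure_pmf.prob (nu_at e (fst (db ! i))) {y. (fst (db ! j), y) \<in> E})"
proof -
  let ?P = "measure_pmf.prob (nu_at e (fst (db ! i)))"
  let ?C = "{y. correct_answer E db y (run_query D t db y)}"
  let ?N = "\<Union>j\<in>{..<n} - {i}. {y. (fst (db ! j), y) \<in> E}"
  have "?P (wrong db (snd (db ! i))) \<le> ?P ((UNIV - ?C) \<union> ?N)"
  proof (rule measure_pmf.finite_measure_mono_AE)
    show "AE y in nu_at e (fst (db ! i)). y \<in> wrong db (snd (db ! i)) \<longrightarrow> y \<in> (UNIV - ?C) \<union> ?N"
      unfolding AE_measure_pmf_iff
    proof (intro ballI impI, rule ccontr)
      fix y assume y: "y \<in> set_pmf (nu_at e (fst (db ! i)))" "y \<in> wrong db (snd (db ! i))"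
        and notin: "y \<notin> (UNIV - ?C) \<union> ?N"
      have "(fst (db ! i), y) \<in> E"
        using y(1) set_nu_at[OF databasesD(3)[OF db i]] set_e_E by auto
      then have "unique_neighbour E db y i"
        using notin i databasesD(2)[OF db] by (auto simp: unique_neighbour_def)
      then show False
        using notin y(2) by (auto simp: correct_answer_def wrong_def)
    qed
  qed simp
  also have "\<dots> \<le> ?P (UNIV - ?C) + ?P ?N" by (intro measure_Un_le) auto
  also have "?P (UNIV - ?C) = 1 - ?P ?C"
    using measure_pmf.prob_compl[of ?C "nu_at e (fst (db ! i))"] by simp
  also have "?P ?N \<le> (\<Sum>j\<in>{..<n} - {i}. ?P {y. (fst (db ! j), y) \<in> E})"
    by (intro measure_UNION_le) auto
  finally show ?thesis by simp
qed

text \<open>Failures contribute \<open>\<gamma> * n\<close>, and collisions contribute at most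
  \<open>\<gamma> / n\<close> for each of fewer than \<open>n\<close> other positions per
  index.\<close>

lemma avg_wrong:
  assumes n: "0 < n" and \<gamma>: "0 \<le> \<gamma>" and wi: "weak_independence E e \<gamma> n"
    and succ: "1 - \<gamma> \<le> success_probability E e n t D"
  shows "avg databases (\<lambda>db. \<Sum>i<n.
    measure_pmf.prob (nu_at e (fst (db ! i))) (wrong db (snd (db ! i)))) \<le> 2 * \<gamma> * n"
proof -
  let ?P = "\<lambda>db i. measure_pmf.prob (nu_at e (fst (db ! i)))"
  let ?C = "\<lambda>db. {y. correct_answer E db y (run_query D t db y)}"
  have "avg databases (\<lambda>db. \<Sum>i<n. ?P db i (wrong db (snd (db ! i)))) \<le>
    avg databases (\<lambda>db. (real n + (- 1) * (\<Sum>i<n. ?P db i (?C db)))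
      + (\<Sum>i<n. \<Sum>j\<in>{..<n} - {i}. ?P db i {y. (fst (db ! j), y) \<in> E}))"
  proof (rule avg_mono)
    fix db assume db: "db \<in> set_pmf databases"
    have "(\<Sum>i<n. ?P db i (wrong db (snd (db ! i)))) \<le>
      (\<Sum>i<n. (1 - ?P db i (?C db)) + (\<Sum>j\<in>{..<n} - {i}. ?P db i {y. (fst (db ! j), y) \<in> E}))"
      by (intro sum_mono prob_wrong_le[OF db]) auto
    then show "(\<Sum>i<n. ?P db i (wrong db (snd (db ! i)))) \<le> (real n + (- 1) * (\<Sum>i<n. ?P db i (?C db)))
      + (\<Sum>i<n. \<Sum>j\<in>{..<n} - {i}. ?P db i {y. (fst (db ! j), y) \<in> E})"
      by (simp add: sum.distrib sum_subtractf)
  qed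
  also have "\<dots> = real n - avg databases (\<lambda>db. \<Sum>i<n. ?P db i (?C db))
      + (\<Sum>i<n. \<Sum>j\<in>{..<n} - {i}. avg databases (\<lambda>db. ?P db i {y. (fst (db ! j), y) \<in> E}))"
    unfolding avg_add avg_cmult avg_sum by (simp add: avg_const)
  also have "avg databases (\<lambda>db. \<Sum>i<n. ?P db i (?C db)) = n * success_probability E e n t D"
    using n by (simp add: success_probability_eq avg_divide)
  also have "(\<Sum>i<n. \<Sum>j\<in>{..<n} - {i}. avg databases (\<lambda>db. ?P db i {y. (fst (db ! j), y) \<in> E}))
      \<le> (\<Sum>i<n. \<Sum>j\<in>{..<n} - {i}. \<gamma> / n)"
    by (intro sum_mono avg_collision[OF wi]) auto
  also have "\<dots> \<le> (\<Sum>i<n. \<gamma>)"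
  proof (rule sum_mono)
    fix i assume "i \<in> {..<n}"
    have "(\<Sum>j\<in>{..<n} - {i}. \<gamma> / n) \<le> (\<Sum>j\<in>{..<n}. \<gamma> / n)"
      using \<gamma> by (intro sum_mono2) auto
    then show "(\<Sum>j\<in>{..<n} - {i}. \<gamma> / n) \<le> \<gamma>" using n by simp
  qed
  finally show ?thesis
    using mult_left_mono[OF succ, of "real n"] by (simp add: algebra_simps)
qed

section \<open>Few sampled cells cannot describe the database\<close>

definition cells where "cells s = (\<Sum>k<t. card (s k))"

lemma avg_cells: "avg samples (\<lambda>Ss. real (cells ((!) Ss))) = t * (p * (3 * m))"
proof -
  have "avg samples (\<lambda>Ss. real (card (Ss ! k))) = p * (3 * m)" if "k < t" for k
  proof -
    have "avg samples (\<lambda>Ss. real (card (Ss ! k))) =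
      avg samples (\<lambda>Ss. avg (random_subset p (3 * m)) (\<lambda>S. real (card (Ss[k := S] ! k))))"
      using that by (intro avg_resample) auto
    also have "\<dots> = avg samples (\<lambda>Ss. avg (random_subset p (3 * m)) (\<lambda>S. \<Sum>q\<in>S. 1))"
      using that by (intro avg_cong) (auto simp: set_replicate_pmf)
    also have "\<dots> = p * (3 * m)"
      by (simp only: avg_sum_random_subset[OF p] avg_const finite_samples) simp
    finally show ?thesis .
  qed
  then show ?thesis
    by (simp add: cells_def avg_sum)
qed

definition many_unshattered where
  "many_unshattered C s db \<longleftrightarrow> 1 / 8 * real n \<le> card {i. i < n \<and> \<not> shattered C s (fst (db ! i))}"

definition many_guessed where
  "many_guessed C s db \<longleftrightarrow> 3 / 4 * real n \<le> card {i. i < n \<and> guess C s (fst (db ! i)) = snd (db ! i)}"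

text \<open>The failure probability \<open>\<gamma>\<close> is so small that even the union over all contents of the sampled
  cells is harmless.\<close>

lemma prob_many_unshattered:
  assumes \<gamma>: "\<gamma> = 1 / 2 ^ 80"
  shows "measure_pmf.prob databases {db. many_unshattered C s db} \<le> (1 / 512) ^ n"
proof -
  let ?Q = "\<lambda>a. \<not> shattered C s (fst a)"
  have "measure_pmf.prob (pair_pmf (mu e) coin) {a. ?Q a} = measure_pmf.prob (map_pmf fst (pair_pmf (mu e) coin)) {x. \<not> shattered C s x}"
    by (simp add: vimage_def del: map_fst_pair_pmf)
  also have "\<dots> \<le> \<gamma>"
    unfolding map_fst_pair_pmf by (rule prob_not_shattered)
  \<comment> \<open>The base \<open>s = 2 ^ 80\<close> is \<open>1 / \<gamma>\<close>: the numerator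
    stays below \<open>2\<close> and the denominator is \<open>2 ^ 10\<close>.\<close>
  finally have "measure_pmf.prob databases {db. many_unshattered C s db}
      \<le> ((1 + \<gamma> * (2 ^ 80 - 1)) / (2 ^ 80) powr (1 / 8)) ^ n"
    unfolding many_unshattered_def by (intro prob_count_ge) auto
  also have "(2 ^ 80 :: real) powr (1 / 8) = 2 ^ 10"
    by (simp add: powr_realpow[symmetric] powr_powr del: powr_numeral)
  also have "((1 + \<gamma> * (2 ^ 80 - 1)) / 2 ^ 10) ^ n \<le> (1 / 512) ^ n"
    unfolding \<gamma> by (intro power_mono) auto
  finally show ?thesis .
qed

text \<open>For fixed contents the guess depends on the point alone, so it matches the independent
  fair bit with probability \<open>1 / 2\<close>. The Chernoff bound is taken with base
  \<open>4\<close>.\<close>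

lemma prob_many_guessed:
  "measure_pmf.prob databases {db. many_guessed C s db} \<le> (885 / 1000) ^ n"
proof -
  let ?Q = "\<lambda>a. guess C s (fst a) = snd a"
  have "measure_pmf.prob (pair_pmf (mu e) coin) {a. ?Q a} = avg (mu e) (\<lambda>x. avg coin (\<lambda>b. indicator {a. ?Q a} (x, b)))"
    by (simp only: prob_eq_avg finite_entry) (simp add: avg_pair)
  also have "\<dots> = 1 / 2"
    by (simp add: avg_pmf_of_set UNIV_bool indicator_def avg_const)
  finally have "measure_pmf.prob databases {db. many_guessed C s db}
      \<le> ((1 + 1 / 2 * (4 - 1)) / 4 powr (3 / 4)) ^ n"
    unfolding many_guessed_def by (intro prob_count_ge) auto
  also have "\<dots> \<le> (885 / 1000) ^ n"
  proof (rule power_mono)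
    \<comment> \<open>The denominator is the square root of \<open>8\<close>, which exceeds
      \<open>2.825\<close>.\<close>
    have "(4 powr (3 / 4))\<^sup>2 = (4 :: real) powr (3 / 2)"
      by (simp add: power2_eq_square powr_add[symmetric])
    also have "\<dots> = (2 powr 2) powr (3 / 2)" by simp
    also have "\<dots> = 2 powr 3" unfolding powr_powr by simp
    also have "\<dots> = (8 :: real)" by simp
    finally have "(2825 / 1000)\<^sup>2 \<le> (4 powr (3 / 4) :: real)\<^sup>2"
      by (simp add: power2_eq_square)
    then have "2825 / 1000 \<le> (4 powr (3 / 4) :: real)"
      by (rule power2_le_imp_le) simp
    then show "(1 + 1 / 2 * (4 - 1)) / 4 powr (3 / 4) \<le> (885 / 1000 :: real)"
      by (simp add: field_simps)
  qed simp
  finally show ?thesis .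
qed

text \<open>The true contents depend on the database, so the fixed-contents bounds apply only after
  a union over all codes. There are \<open>2 ^ (w * cells s)\<close> of these, few enough for the
  exponentially small probabilities to absorb.\<close>

lemma prob_decoding:
  assumes \<gamma>: "\<gamma> = 1 / 2 ^ 80" and n: "0 < n" and s: "\<And>k. k < t \<Longrightarrow> s k \<subseteq> {..<3 * m}"
    and few: "10 * (w * cells s) \<le> n"
  shows "measure_pmf.prob databases {db. many_unshattered (truth db) s db \<or> many_guessed (truth db) s db}
    \<le> 96 / 100"
proof -
  define X where "X = Pi\<^sub>E (SIGMA k:{..<t}. s k) (\<lambda>_. {bs :: bool list. length bs = w})"
  define C where "C \<sigma> = (\<lambda>k q (l::nat). \<sigma> (k, q))" for \<sigma> :: "nat \<times> nat \<Rightarrow> bool list"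
  have fin_s: "finite (s k)" if "k < t" for k using s[OF that] finite_subset by auto
  have words: "{bs :: bool list. length bs = w} = {bs. set bs \<subseteq> UNIV \<and> length bs = w}" by auto
  have finX: "finite X"
    unfolding X_def words using fin_s by (intro finite_PiE finite_SigmaI finite_lists_length_eq) auto
  have card_words: "card {bs :: bool list. length bs = w} = 2 ^ w"
    unfolding words by (subst card_lists_length_eq) auto
  have "card X = (2 ^ w) ^ card (SIGMA k:{..<t}. s k)"
    unfolding X_def using fin_s by (subst card_PiE) (auto simp: card_words)
  also have "card (SIGMA k:{..<t}. s k) = cells s"
    unfolding cells_def using fin_s by (intro card_SigmaI) auto
  finally have cardX: "card X = 2 ^ (w * cells s)" by (simp add: power_mult)
  \<comment> \<open>Since \<open>1.08 ^ 10\<close> exceeds \<open>2\<close>, at most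
    \<open>n / 10\<close> bits give at most \<open>1.08 ^ n\<close> codes; the product of
    \<open>1.08\<close> and \<open>0.885\<close> is still below \<open>1\<close>.\<close>
  have "real (card X) \<le> ((108 / 100) ^ 10) ^ (w * cells s)"
    unfolding cardX by (simp, intro power_mono) (simp_all add: power_divide)
  also have "\<dots> = (108 / 100) ^ (10 * (w * cells s))" by (simp only: power_mult)
  also have "\<dots> \<le> (108 / 100) ^ n" using few by (intro power_increasing) auto
  finally have cX: "real (card X) \<le> (108 / 100) ^ n" .
  have "measure_pmf.prob databases {db. many_unshattered (truth db) s db \<or> many_guessed (truth db) s db}
    \<le> measure_pmf.prob databases (\<Union>\<sigma>\<in>X. {db. many_unshattered (C \<sigma>) s db} \<union> {db. many_guessed (C \<sigma>) s db})"
  proof (rule measure_pmf.finite_measure_mono_AE)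
    show "AE db in databases. db \<in> {db. many_unshattered (truth db) s db \<or> many_guessed (truth db) s db} \<longrightarrow>
      db \<in> (\<Union>\<sigma>\<in>X. {db. many_unshattered (C \<sigma>) s db} \<union> {db. many_guessed (C \<sigma>) s db})"
      unfolding AE_measure_pmf_iff
    proof (intro ballI impI)
      fix db assume db: "db \<in> set_pmf databases"
        and ev: "db \<in> {db. many_unshattered (truth db) s db \<or> many_guessed (truth db) s db}"
      obtain \<sigma> where \<sigma>: "\<sigma> \<in> X" "\<And>k. k \<le> t \<Longrightarrow> run (C \<sigma>) s k = run (truth db) s k"
        using contents_code[OF databasesD(1)[OF db], of s] unfolding X_def C_def by blast
      have "shattered (C \<sigma>) s x = shattered (truth db) s x" "guess (C \<sigma>) s x = guess (truth db) s x" for x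
        using shattered_cong[OF \<sigma>(2)] guess_cong[OF \<sigma>(2)] by auto
      then have "many_unshattered (C \<sigma>) s db = many_unshattered (truth db) s db"
        "many_guessed (C \<sigma>) s db = many_guessed (truth db) s db"
        by (simp_all only: many_unshattered_def many_guessed_def)
      then show "db \<in> (\<Union>\<sigma>\<in>X. {db. many_unshattered (C \<sigma>) s db} \<union> {db. many_guessed (C \<sigma>) s db})"
        using ev \<sigma>(1) by blast
    qed
  qed simp
  also have "\<dots> \<le> (\<Sum>\<sigma>\<in>X. measure_pmf.prob databases ({db. many_unshattered (C \<sigma>) s db} \<union> {db. many_guessed (C \<sigma>) s db}))"
    using finX by (intro measure_UNION_le) auto
  also have "\<dots> \<le> (\<Sum>\<sigma>\<in>X. (1 / 512) ^ n + (885 / 1000) ^ n)"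
    by (intro sum_mono order_trans[OF measure_Un_le] add_mono prob_many_unshattered[OF \<gamma>] prob_many_guessed) auto
  also have "\<dots> = real (card X) * ((1 / 512) ^ n + (885 / 1000) ^ n)" by simp
  also have "\<dots> \<le> (108 / 100) ^ n * ((1 / 512) ^ n + (885 / 1000) ^ n)"
    using cX by (intro mult_right_mono) auto
  also have "\<dots> = (108 / 51200) ^ n + (9558 / 10000) ^ n"
    by (simp add: distrib_left power_mult_distrib[symmetric])
  also have "\<dots> \<le> (108 / 51200) ^ 1 + (9558 / 10000) ^ 1"
    using n by (intro add_mono power_decreasing) auto
  also have "\<dots> \<le> 96 / 100" by simp
  finally show ?thesis .
qed

text \<open>For every sample and database, many cells are kept, or the total loss is large, or the
  unlikely decoding event occurs. If the bound failed, the three corresponding averages would sum to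
  less than \<open>1\<close>.\<close>

theorem sampled_cells_lower_bound:
  assumes \<gamma>: "\<gamma> = 1 / 2 ^ 80" and n: "0 < n" and wi: "weak_independence E e \<gamma> n"
    and succ: "1 - \<gamma> \<le> success_probability E e n t D"
    and K_large: "p = 1 \<or> (2 ^ 15 * real t)\<^sup>2 \<le> K * p ^ t"
  shows "n < 1000 * (w * (t * (p * (3 * m))))"
proof (rule ccontr)
  assume "\<not> n < 1000 * (w * (t * (p * (3 * m))))"
  then have small: "1000 * (w * (t * (p * (3 * m)))) \<le> n" by simp
  have \<gamma>0: "0 \<le> \<gamma>" by (simp add: \<gamma>)
  define B where "B s = {db. many_unshattered (truth db) s db \<or> many_guessed (truth db) s db}" for s
  define L where "L Ss db = (\<Sum>i<n. loss db ((!) Ss) (fst (db ! i)) (snd (db ! i)))" for Ss db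
  \<comment> \<open>Zero for large samples, which the union bound does not cover; the term in
    \<open>cells\<close> accounts for them.\<close>
  define G where "G Ss db = (if 10 * (w * cells ((!) Ss)) \<le> n then indicator (B ((!) Ss)) db else (0::real))" for Ss db
  have ge1: "1 \<le> 10 * w / n * cells ((!) Ss) + 8 / n * L Ss db + G Ss db"
    if Ss: "Ss \<in> set_pmf samples" and db: "db \<in> set_pmf databases" for Ss db
  proof -
    let ?s = "(!) Ss" and ?T = "truth db"
    have L0: "0 \<le> L Ss db" unfolding L_def by (intro sum_nonneg loss_nonneg \<gamma>0)
    have G0: "0 \<le> G Ss db" by (simp add: G_def)
    consider "n < 10 * (w * cells ?s)" | "real n \<le> 8 * L Ss db"
      | "10 * (w * cells ?s) \<le> n" "8 * L Ss db < real n" by linarith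
    then show ?thesis
    proof cases
      case 1
      then have "real n \<le> real (10 * (w * cells ?s))" by linarith
      then have "1 \<le> 10 * w / n * cells ?s" using n by (simp add: field_simps)
      moreover have "0 \<le> 8 / n * L Ss db" using L0 by simp
      ultimately show ?thesis using G0 by linarith
    next
      case 2
      then have "1 \<le> 8 / n * L Ss db" using n by (simp add: field_simps)
      moreover have "0 \<le> 10 * w / n * cells ?s" by simp
      ultimately show ?thesis using G0 by linarith
    next
      case 3
      let ?x = "\<lambda>i. fst (db ! i)" and ?b = "\<lambda>i. snd (db ! i)"
      let ?R = "{i. i < n \<and> guess ?T ?s (?x i) = ?b i}"
      let ?Un = "{i. i < n \<and> \<not> shattered ?T ?s (?x i)}"
      let ?Lo = "{i. i < n \<and> 1 \<le> loss db ?s (?x i) (?b i)}"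
      have "{..<n} \<subseteq> ?R \<union> ?Un \<union> ?Lo"
        using guess_correct[OF \<gamma>0 databasesD(1)[OF db] databasesD(3)[OF db] samples_nth_subset[OF Ss]]
        by force
      then have "card {..<n} \<le> card (?R \<union> ?Un \<union> ?Lo)" by (intro card_mono) auto
      also have "\<dots> \<le> card ?R + card ?Un + card ?Lo"
        by (meson card_Un_le add_le_mono1 order_trans)
      finally have cover: "real n \<le> card ?R + card ?Un + card ?Lo" by simp
      have "real (card ?Lo) = (\<Sum>i\<in>?Lo. 1)" by simp
      also have "\<dots> \<le> (\<Sum>i\<in>?Lo. loss db ?s (?x i) (?b i))" by (intro sum_mono) auto
      also have "\<dots> \<le> L Ss db"
        unfolding L_def by (intro sum_mono2) (auto simp: loss_nonneg[OF \<gamma>0])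
      finally have "8 * real (card ?Lo) < n" using 3 by linarith
      \<comment> \<open>Fewer than \<open>n / 8\<close> indices have large loss, and
        \<open>1 / 8 + 1 / 8 + 3 / 4 = 1\<close>.\<close>
      then have "many_unshattered ?T ?s db \<or> many_guessed ?T ?s db"
        unfolding many_unshattered_def many_guessed_def using cover by linarith
      then have "G Ss db = 1" using 3 by (simp add: G_def B_def)
      moreover have "0 \<le> 10 * w / n * cells ?s" "0 \<le> 8 / n * L Ss db" using L0 by simp_all
      ultimately show ?thesis by linarith
    qed
  qed
  have "1 = avg samples (\<lambda>Ss. avg databases (\<lambda>db. 1))"
    by (simp only: avg_const finite_samples finite_databases)
  also have "\<dots> \<le> avg samples (\<lambda>Ss. avg databases (\<lambda>db. 10 * w / n * cells ((!) Ss) + 8 / n * L Ss db + G Ss db))"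
    by (intro avg_mono ge1)
  also have "\<dots> = 10 * w / n * avg samples (\<lambda>Ss. cells ((!) Ss)) +
      8 / n * avg samples (\<lambda>Ss. avg databases (L Ss)) + avg samples (\<lambda>Ss. avg databases (G Ss))"
    by (simp only: avg_add avg_cmult avg_const finite_databases)
  also have "10 * w / n * avg samples (\<lambda>Ss. cells ((!) Ss)) \<le> 1 / 100"
    unfolding avg_cells using small n by (simp add: field_simps)
  \<comment> \<open>Here \<open>\<delta> = 1 / 2 ^ 15\<close>, which matches
    \<open>K_large\<close>.\<close>
  also have "8 / n * avg samples (\<lambda>Ss. avg databases (L Ss)) \<le> 128 * \<gamma> + 128 / 2 ^ 15"
  proof -
    have "avg samples (\<lambda>Ss. avg databases (L Ss)) = avg databases (\<lambda>db. avg samples (\<lambda>Ss. L Ss db))"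
      by (rule avg_swap)
    also have "\<dots> \<le> avg databases (\<lambda>db. (8 * \<gamma> + 16 / 2 ^ 15) * n + 4 *
        (\<Sum>i<n. measure_pmf.prob (nu_at e (fst (db ! i))) (wrong db (snd (db ! i)))))"
    proof (rule avg_mono)
      fix db assume db: "db \<in> set_pmf databases"
      have "avg samples (\<lambda>Ss. L Ss db) \<le> (\<Sum>i<n. 8 * \<gamma> + 16 * (1 / 2 ^ 15) +
          4 * measure_pmf.prob (nu_at e (fst (db ! i))) (wrong db (snd (db ! i))))"
        unfolding L_def avg_sum using K_large
        by (intro sum_mono avg_loss) (auto simp: databasesD(3)[OF db] mult.commute)
      then show "avg samples (\<lambda>Ss. L Ss db) \<le> (8 * \<gamma> + 16 / 2 ^ 15) * n + 4 *
        (\<Sum>i<n. measure_pmf.prob (nu_at e (fst (db ! i))) (wrong db (snd (db ! i))))"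
        by (simp add: sum.distrib sum_distrib_left algebra_simps)
    qed
    also have "\<dots> \<le> (8 * \<gamma> + 16 / 2 ^ 15) * n + 4 * (2 * \<gamma> * n)"
      unfolding avg_add avg_cmult using avg_wrong[OF n \<gamma>0 wi succ]
      by (simp add: avg_const del: set_pair_pmf)
    also have "\<dots> = (16 * \<gamma> + 16 / 2 ^ 15) * n" by (simp add: algebra_simps)
    finally have "8 / n * avg samples (\<lambda>Ss. avg databases (L Ss)) \<le> 8 / n * ((16 * \<gamma> + 16 / 2 ^ 15) * n)"
      by (intro mult_left_mono) auto
    then show ?thesis using n by simp
  qed
  also have "avg samples (\<lambda>Ss. avg databases (G Ss)) \<le> avg samples (\<lambda>Ss. 96 / 100)"
  proof (rule avg_mono)
    fix Ss assume Ss: "Ss \<in> set_pmf samples"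
    show "avg databases (G Ss) \<le> 96 / 100"
    proof (cases "10 * (w * cells ((!) Ss)) \<le> n")
      case True
      then have "avg databases (G Ss) = measure_pmf.prob databases (B ((!) Ss))"
        by (simp only: prob_eq_avg finite_databases) (simp add: G_def[abs_def])
      also have "\<dots> \<le> 96 / 100"
        unfolding B_def using True samples_nth_subset[OF Ss] by (intro prob_decoding[OF \<gamma> n]) auto
      finally show ?thesis .
    next
      case False
      then have "G Ss = (\<lambda>db. 0)" by (simp add: G_def[abs_def])
      then show ?thesis by (simp add: avg_def)
    qed
  qed
  also have "avg samples (\<lambda>Ss. 96 / 100) = 96 / 100"
    by (simp only: avg_const finite_samples)
  \<comment> \<open>The total is at most
    \<open>1 / 100 + 128 * \<gamma> + 1 / 256 + 96 / 100\<close>, which is below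
    \<open>1\<close>.\<close>
  finally show False by (simp add: \<gamma>)
qed

end

section \<open>The space lower bound\<close>

theorem theorem8:
  shows "\<exists>\<gamma>::real. 0 < \<gamma> \<and> \<gamma> < 1 \<and> (\<exists>c::real. 0 < c \<and>
    (\<forall>(U::nat set) (V::nat set) E e (n::nat) (t::nat) (m::nat) (w::nat) (K::real) D.
       weighted_bipartite U V E e \<longrightarrow>
       0 < t \<longrightarrow> 0 < m \<longrightarrow> 0 < w \<longrightarrow> 0 < K \<longrightarrow>
       (\<forall>y\<in>V. pmf (nu e) y \<le> 1 / real m) \<longrightarrow>
       weak_independence E e \<gamma> n \<longrightarrow>
       weak_shattering_property V e K (1 / real m) (\<gamma> / real t) \<longrightarrow>
       real t \<le> real n powr (1 / 4) \<longrightarrow>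
       cell_probe_structure U V n t m w D \<longrightarrow>
       success_probability E e n t D \<ge> 1 - \<gamma> \<longrightarrow>
       real m \<ge> c * (\<gamma> ^ 3 * real n * K powr (1 / (2 * real t))
                       / (real w * real t ^ 3 * ln (real t / \<gamma>)))))"
proof -
  define \<gamma> :: real where "\<gamma> = 1 / 2 ^ 80"
  \<comment> \<open>The factor \<open>1000 * 3\<close> comes from the bound on sampled cells,
    \<open>2 ^ 16\<close> from the choice of \<open>p\<close>.\<close>
  define c :: real where "c = 1 / (3000 * 2 ^ 16)"
  have "c * (\<gamma> ^ 3 * real n * K powr (1 / (2 * real t)) / (real w * real t ^ 3 * ln (real t / \<gamma>))) \<le> real m"
    if graph: "weighted_bipartite U V E e"
      and pos: "0 < t" "0 < m" "0 < w" "0 < K"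
      and light: "\<forall>y\<in>V. pmf (nu e) y \<le> 1 / real m"
      and wi: "weak_independence E e \<gamma> n"
      and sh: "weak_shattering_property V e K (1 / real m) (\<gamma> / real t)"
      and tn: "real t \<le> real n powr (1 / 4)"
      and cps: "cell_probe_structure U V n t m w D"
      and succ: "1 - \<gamma> \<le> success_probability E e n t D"
    for U V :: "nat set" and E e n t m w K D
  proof -
    \<comment> \<open>For \<open>n = 0\<close> the bound \<open>tn\<close> would force
      \<open>t = 0\<close>.\<close>
    have n: "0 < n" using tn pos by (cases "n = 0") auto
    define \<kappa> where "\<kappa> = K powr (1 / (2 * real t))"
    define p where "p = min 1 (2 ^ 16 / \<kappa>)"
    have \<kappa>: "0 < \<kappa>" using pos by (simp add: \<kappa>_def)
    have p: "0 < p" "p \<le> 1" using \<kappa> by (auto simp: p_def)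
    have p_le: "p \<le> 2 ^ 16 / \<kappa>" by (simp add: p_def)
    have K_large: "p = 1 \<or> (2 ^ 15 * real t)\<^sup>2 \<le> K * p ^ t"
    proof (cases "2 ^ 16 / \<kappa> < 1")
      case True
      have "\<kappa> ^ (2 * t) = \<kappa> powr real (2 * t)" using \<kappa> by (rule powr_realpow[symmetric])
      also have "\<dots> = K" using pos by (simp add: \<kappa>_def powr_powr)
      finally have K: "K = \<kappa> ^ t * \<kappa> ^ t" by (simp add: mult_2 power_add)
      \<comment> \<open>By \<open>t \<le> 2 ^ t\<close>, one factor \<open>(2 ^ 16) ^ t\<close>
        absorbs \<open>2 ^ 15 * t\<close>. After squaring, the second such factor is at most
        \<open>\<kappa> ^ t\<close>, and \<open>K * p ^ t\<close> equals
        \<open>(2 ^ 16) ^ t * \<kappa> ^ t\<close>.\<close>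
      have "(2 ^ 15 * real t) \<le> (2 ^ 16) ^ t"
      proof -
        have "real t \<le> 2 ^ t" using less_exp[of t] by (metis less_imp_le of_nat_le_iff of_nat_numeral of_nat_power)
        moreover have "(2 ^ 15 :: real) \<le> (2 ^ 15) ^ t" using pos by (intro self_le_power) auto
        ultimately have "2 ^ 15 * real t \<le> (2 ^ 15) ^ t * 2 ^ t" by (intro mult_mono) auto
        then show ?thesis by (simp add: power_mult_distrib[symmetric])
      qed
      then have "(2 ^ 15 * real t)\<^sup>2 \<le> ((2 ^ 16) ^ t)\<^sup>2" by (intro power_mono) auto
      also have "\<dots> \<le> (2 ^ 16) ^ t * \<kappa> ^ t"
        unfolding power2_eq_square using True \<kappa> by (intro mult_left_mono power_mono) auto
      also have "\<dots> = K * p ^ t"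
        using True \<kappa> by (simp add: K p_def power_divide)
      finally show ?thesis by simp
    qed (simp add: p_def)
    interpret cell_sampling U V E e n t m w K \<gamma> p D
      by unfold_locales (fact graph pos light sh cps p)+
    have "real n < 1000 * (w * (t * (p * (3 * m))))"
      by (rule sampled_cells_lower_bound[OF \<gamma>_def n wi succ K_large])
    also have "\<dots> \<le> 1000 * (w * (t * (2 ^ 16 / \<kappa> * (3 * m))))"
      using p_le by (intro mult_left_mono mult_right_mono) auto
    finally have *: "c * (real n * \<kappa>) \<le> m * (real w * real t)"
      using \<kappa> by (simp add: c_def field_simps)
    \<comment> \<open>From here \<open>*\<close> is only weakened: the logarithm and
      \<open>t ^ 2\<close> are at least \<open>1\<close>, and \<open>\<gamma> ^ 3\<close> is at most
      \<open>1\<close>.\<close>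
    have "1 \<le> ln (real t / \<gamma>)"
    proof -
      have "exp 1 \<le> (3::real)" by (rule exp_le)
      also have "\<dots> \<le> 1 * 2 ^ 80" by simp
      also have "\<dots> \<le> real t / \<gamma>" unfolding \<gamma>_def using pos by simp
      finally show ?thesis using pos by (subst ln_ge_iff) (auto simp: \<gamma>_def)
    qed
    moreover have "real t \<le> real t ^ 3" using pos by (intro self_le_power) auto
    ultimately have "real t * 1 \<le> real t ^ 3 * ln (real t / \<gamma>)" by (intro mult_mono) auto
    then have den: "real w * real t \<le> real w * real t ^ 3 * ln (real t / \<gamma>)"
      by (simp add: mult.assoc mult_left_mono)
    have wt: "0 < real w * real t" using pos by simp
    have "\<gamma> ^ 3 \<le> 1" by (intro power_le_one) (auto simp: \<gamma>_def)
    then have "\<gamma> ^ 3 * (real n * \<kappa>) \<le> 1 * (real n * \<kappa>)" using \<kappa> by (intro mult_right_mono) auto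
    then have "\<gamma> ^ 3 * real n * \<kappa> / (real w * real t ^ 3 * ln (real t / \<gamma>)) \<le> real n * \<kappa> / (real w * real t)"
      using den wt \<kappa> by (intro frac_le) (auto simp: mult.assoc)
    then have "c * (\<gamma> ^ 3 * real n * \<kappa> / (real w * real t ^ 3 * ln (real t / \<gamma>))) \<le> c * (real n * \<kappa> / (real w * real t))"
      by (intro mult_left_mono) (auto simp: c_def)
    also have "\<dots> \<le> m" using * wt by (simp add: pos_divide_le_eq)
    finally show ?thesis by (simp only: \<kappa>_def)
  qed
  moreover have "0 < \<gamma>" "\<gamma> < 1" "0 < c" by (simp_all add: \<gamma>_def c_def)
  ultimately show ?thesis by blast
qed

end
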